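(* Let $\Delta\ge 3$, $c\in[0,\Delta-2]$, $\kappa=\Delta+c$. Against an oblivious adversary, the expected recourse of each update performed by {\textsc{DistMaint}} (in the rooted version and in the general unrooted version) on a fully dynamic forest of maximum degree at most $\Delta$ on $n$ vertices is at most $\frac{\Delta}{\kappa}\cdot\min\left\{\frac{\kappa-1}{c},\ 2+\lceil\log_{\kappa-1}n\rceil\right\}$ if $c\ge1$, and at most $2+\lceil\log_{\Delta-1}n\rceil$ if $c=0$.
   Context: Updates (fixed in advance) are insertions of edges joining two distinct trees and deletions; the forest starts empty; in the rooted version an insertion $(p,r)$ requires $r$ to be a root and makes it a child of $p$, and deleting $(p,r)$ with $p$ the parent of $r$ makes $r$ a root. $A(x)$ = colors of $[\kappa]$ not used at $x$. Recourse of an update = number of previously colored edges whose color changes. {\textsc{DistMaint}}: trees have designated roots (initially each vertex). FixForbidden$(v,\alpha,\beta)$: if no child edge of $v$ has color $\beta$ stop; else recolor that child edge $(v,w)$ to $\alpha$ and call FixForbidden$(w,\beta,\alpha)$. Rooted insertion $(p,r)$: choose $\beta$ uniformly from $A(p)$, color $(p,r)$ by $\beta$; if no child edge of $r$ has color $\beta$ stop; else for that edge $(r,w)$ choose $\alpha$ uniformly from $A(r)$, recolor $(r,w)$ to $\alpha$, call FixForbidden$(w,\beta,\alpha)$. In the unrooted version, an insertion $(u,v)$ first names endpoints so $\deg(v)\le\deg(u)$ if both trees have at most $\Delta$ edges and otherwise so $v$'s tree has at most as many edges, reroots $v$'s tree at $v$, then does the rooted insertion $(u,v)$. Deletion of $(p,r)$,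 $p$ the parent of $r$ in the current rooting, color $\alpha$: delete; with $\ell$ the number of children of $r$, with probability $(\kappa-\ell)/\kappa$ stop; else pick a uniformly random child $w$, $\beta=\mathrm{color}(r,w)$, recolor $(r,w)$ to $\alpha$, call FixForbidden$(w,\beta,\alpha)$. Random choices independent. *)

theory Defs
  imports "HOL-Probability.Probability"
begin

section \<open>Forests\<close>

text \<open>
  The vertices are the elements of a finite type. A rooted forest is given by its parent map
  (\<open>None\<close> for roots). Edges are unordered pairs, so the identity of an edge, and hence
  its colour, is unaffected by rerooting.
\<close>

type_synonym 'v parents = "'v \<Rightarrow> 'v option"

definition edges :: "'v parents \<Rightarrow> 'v set set" where
  "edges par = {{p, r} | p r. par r = Some p}"

definition same_tree :: "'v set set \<Rightarrow> 'v \<Rightarrow> 'v \<Rightarrow> bool" where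
  "same_tree E u v \<longleftrightarrow> (u, v) \<in> {(x, y). {x, y} \<in> E}\<^sup>*"

definition degree :: "'v set set \<Rightarrow> 'v \<Rightarrow> nat" where
  "degree E v = card {e \<in> E. v \<in> e}"

definition tree_edges :: "'v set set \<Rightarrow> 'v \<Rightarrow> nat" where
  "tree_edges E v = card {e \<in> E. \<exists>x \<in> e. same_tree E v x}"

definition children :: "'v parents \<Rightarrow> 'v \<Rightarrow> 'v set" where
  "children par v = {w. par w = Some v}"

definition ancestor :: "'v parents \<Rightarrow> 'v \<Rightarrow> 'v \<Rightarrow> bool" where
  "ancestor par v x \<longleftrightarrow> (v, x) \<in> {(y, p). par y = Some p}\<^sup>*"

text \<open>Rerooting at \<open>v\<close> reverses the path from \<open>v\<close> to the old root.\<close>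

definition reroot :: "'v \<Rightarrow> 'v parents \<Rightarrow> 'v parents" where
  "reroot v par = (\<lambda>x.
     if x = v then None
     else if ancestor par v x then Some (THE y. par y = Some x \<and> ancestor par v y)
     else par x)"


section \<open>Update sequences\<close>

datatype version = Rooted | Unrooted

datatype 'v update = Insert 'v 'v | Delete 'v 'v

text \<open>
  Legality of an update sequence refers only to the forest, never to the colours, so a legal
  sequence is one that can be fixed in advance. In the rooted version the updates
  are the pairs (parent, child) and determine the rooting; in the unrooted version they determine
  only the set of edges.
\<close>

fun legal_rooted :: "nat \<Rightarrow> 'v parents \<Rightarrow> 'v update list \<Rightarrow> bool" where
  "legal_rooted \<Delta> par [] \<longleftrightarrow> True"
| "legal_rooted \<Delta> par (Insert p r # us) \<longleftrightarrow>
     par r = None \<and> \<not> same_tree (edges par) p r \<and>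
     (\<forall>x. degree (edges (par(r \<mapsto> p))) x \<le> \<Delta>) \<and>
     legal_rooted \<Delta> (par(r \<mapsto> p)) us"
| "legal_rooted \<Delta> par (Delete p r # us) \<longleftrightarrow>
     par r = Some p \<and> legal_rooted \<Delta> (par(r := None)) us"

fun legal_unrooted :: "nat \<Rightarrow> 'v set set \<Rightarrow> 'v update list \<Rightarrow> bool" where
  "legal_unrooted \<Delta> E [] \<longleftrightarrow> True"
| "legal_unrooted \<Delta> E (Insert u v # us) \<longleftrightarrow>
     \<not> same_tree E u v \<and>
     (\<forall>x. degree (insert {u, v} E) x \<le> \<Delta>) \<and>
     legal_unrooted \<Delta> (insert {u, v} E) us"
| "legal_unrooted \<Delta> E (Delete u v # us) \<longleftrightarrow>
     {u, v} \<in> E \<and> legal_unrooted \<Delta> (E - {{u, v}}) us"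

fun legal :: "version \<Rightarrow> nat \<Rightarrow> 'v update list \<Rightarrow> bool" where
  "legal Rooted \<Delta> us = legal_rooted \<Delta> (\<lambda>_. None) us"
| "legal Unrooted \<Delta> us = legal_unrooted \<Delta> {} us"


section \<open>The algorithm\<close>

text \<open>The colours are \<open>{1..\<kappa>}\<close>; the domain of a colouring is the current set of edges.\<close>

type_synonym 'v colouring = "'v set \<Rightarrow> nat option"

type_synonym 'v state = "'v parents \<times> 'v colouring"

definition available :: "nat \<Rightarrow> 'v colouring \<Rightarrow> 'v \<Rightarrow> nat set" where
  "available \<kappa> col x = {1..\<kappa>} - {\<gamma>. \<exists>e. x \<in> e \<and> col e = Some \<gamma>}"

definition coloured_child :: "'v parents \<Rightarrow> 'v colouring \<Rightarrow> 'v \<Rightarrow> nat \<Rightarrow> 'v \<Rightarrow> bool" where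
  "coloured_child par col v \<beta> w \<longleftrightarrow> w \<in> children par v \<and> col {v, w} = Some \<beta>"

text \<open>
  The recursion descends in the tree, so it ends on every actual forest. Its equation holds
  unconditionally because it is tail recursive.
\<close>

partial_function (tailrec) fix_forbidden ::
  "'v parents \<Rightarrow> 'v \<Rightarrow> nat \<Rightarrow> nat \<Rightarrow> 'v colouring \<Rightarrow> 'v colouring" where
  "fix_forbidden par v \<alpha> \<beta> col =
     (if \<exists>w. coloured_child par col v \<beta> w
      then fix_forbidden par (THE w. coloured_child par col v \<beta> w) \<beta> \<alpha>
             (col({v, THE w. coloured_child par col v \<beta> w} \<mapsto> \<alpha>))
      else col)"

definition rooted_insert :: "nat \<Rightarrow> 'v \<Rightarrow> 'v \<Rightarrow> 'v state \<Rightarrow> 'v state pmf" where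
  "rooted_insert \<kappa> p r = (\<lambda>(par, col).
     do {
       \<beta> \<leftarrow> pmf_of_set (available \<kappa> col p);
       let par' = par(r \<mapsto> p);
       let col' = col({p, r} \<mapsto> \<beta>);
       if \<exists>w. coloured_child par' col' r \<beta> w
       then do {
         let w = (THE w. coloured_child par' col' r \<beta> w);
         \<alpha> \<leftarrow> pmf_of_set (available \<kappa> col' r);
         return_pmf (par', fix_forbidden par' w \<beta> \<alpha> (col'({r, w} \<mapsto> \<alpha>)))
       }
       else return_pmf (par', col')
     })"

definition rooted_delete :: "nat \<Rightarrow> 'v \<Rightarrow> 'v \<Rightarrow> 'v state \<Rightarrow> 'v state pmf" where
  "rooted_delete \<kappa> p r = (\<lambda>(par, col).
     do {
       let \<alpha> = the (col {p, r});
       let par' = par(r := None);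
       let col' = col({p, r} := None);
       let l = card (children par' r);
       stop \<leftarrow> bernoulli_pmf ((real \<kappa> - real l) / real \<kappa>);
       if stop then return_pmf (par', col')
       else do {
         w \<leftarrow> pmf_of_set (children par' r);
         let \<beta> = the (col' {r, w});
         return_pmf (par', fix_forbidden par' w \<beta> \<alpha> (col'({r, w} \<mapsto> \<alpha>)))
       }
     })"

text \<open>
  Whether the endpoints \<open>u\<close>, \<open>v\<close> may be named so that \<open>v\<close> becomes the child. If both namings are
  admissible, the one given by the update is kept; as the update sequence is arbitrary, this
  covers every way of breaking ties.
\<close>

definition admissible_naming :: "nat \<Rightarrow> 'v set set \<Rightarrow> 'v \<Rightarrow> 'v \<Rightarrow> bool" where
  "admissible_naming \<Delta> E u v \<longleftrightarrow>
     (if tree_edges E u \<le> \<Delta> \<and> tree_edges E v \<le> \<Delta>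
      then degree E v \<le> degree E u
      else tree_edges E v \<le> tree_edges E u)"

definition unrooted_insert :: "nat \<Rightarrow> nat \<Rightarrow> 'v \<Rightarrow> 'v \<Rightarrow> 'v state \<Rightarrow> 'v state pmf" where
  "unrooted_insert \<Delta> \<kappa> u v = (\<lambda>(par, col).
     if admissible_naming \<Delta> (edges par) u v
     then rooted_insert \<kappa> u v (reroot v par, col)
     else rooted_insert \<kappa> v u (reroot u par, col))"

definition unrooted_delete :: "nat \<Rightarrow> 'v \<Rightarrow> 'v \<Rightarrow> 'v state \<Rightarrow> 'v state pmf" where
  "unrooted_delete \<kappa> u v = (\<lambda>(par, col).
     if par v = Some u then rooted_delete \<kappa> u v (par, col)
     else rooted_delete \<kappa> v u (par, col))"

fun dist_maint_step ::
  "version \<Rightarrow> nat \<Rightarrow> nat \<Rightarrow> 'v update \<Rightarrow> 'v state \<Rightarrow> 'v state pmf" where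
  "dist_maint_step Rooted \<Delta> \<kappa> (Insert p r) = rooted_insert \<kappa> p r"
| "dist_maint_step Rooted \<Delta> \<kappa> (Delete p r) = rooted_delete \<kappa> p r"
| "dist_maint_step Unrooted \<Delta> \<kappa> (Insert u v) = unrooted_insert \<Delta> \<kappa> u v"
| "dist_maint_step Unrooted \<Delta> \<kappa> (Delete u v) = unrooted_delete \<kappa> u v"

definition dist_maint ::
  "version \<Rightarrow> nat \<Rightarrow> nat \<Rightarrow> 'v update list \<Rightarrow> 'v state pmf" where
  "dist_maint ver \<Delta> \<kappa> us =
     foldl (\<lambda>S u. bind_pmf S (dist_maint_step ver \<Delta> \<kappa> u))
       (return_pmf ((\<lambda>_. None), (\<lambda>_. None))) us"


section \<open>Recourse\<close>

text \<open>An inserted edge was not coloured before and a deleted edge has no new colour, so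
  neither is counted.\<close>

definition recourse :: "'v state \<Rightarrow> 'v state \<Rightarrow> nat" where
  "recourse s s' = card {e \<in> dom (snd s) \<inter> dom (snd s'). snd s e \<noteq> snd s' e}"

text \<open>The expectation is over the random choices in the first \<open>i\<close> updates and in the
  update at (zero-based) position \<open>i\<close> itself.\<close>

definition expected_recourse ::
  "version \<Rightarrow> nat \<Rightarrow> nat \<Rightarrow> 'v update list \<Rightarrow> nat \<Rightarrow> real" where
  "expected_recourse ver \<Delta> \<kappa> us i =
     measure_pmf.expectation
       (do {
          s \<leftarrow> dist_maint ver \<Delta> \<kappa> (take i us);
          s' \<leftarrow> dist_maint_step ver \<Delta> \<kappa> (us ! i) s;
          return_pmf (recourse s s')
        })
       real"

end

theory Submission
  imports Defs
begin

text \<open>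
  At every moment the colouring is uniformly distributed over all proper \<open>\<kappa>\<close>-colourings of the
  current forest. Recolouring the edge above \<open>w\<close> and repairing the conflict flips a two-coloured
  path going down from \<open>w\<close>; this flip is undone by flipping back, so it matches the random choices of
  an insertion with those of the corresponding deletion, and both carry the uniform distribution to
  the uniform distribution. Rerooting does not change the set of proper colourings.

  Under the uniform distribution, permuting colours below a vertex shows that a path continues to
  a given child with probability \<open>1 / (\<kappa> - 1)\<close>. Hence the expected length \<open>R w\<close> of a path starting
  at \<open>w\<close> is at most \<open>1 + (\<Sum>x. R x) / (\<kappa> - 1)\<close>, the sum ranging over the children of \<open>w\<close>, and any
  solution of the reverse inequality is an upper bound. An update starts a path below \<open>r\<close> with
  probability \<open>l / \<kappa>\<close>, where \<open>l \<le> \<Delta>\<close> is the number of children of \<open>r\<close>.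
\<close>

section \<open>Rooted forests\<close>

text \<open>The random choices are weighted so that uniformity survives exactly. Let
  \<open>r\<close> have \<open>l\<close> children. In an insertion of \<open>{p, r}\<close> every
  colouring of the linked forest arises once without conflict and once through each child, the
  latter with extra weight \<open>1 / (\<kappa> - l)\<close>; the total
  \<open>\<kappa> / (\<kappa> - l)\<close> is the same for all. In a deletion, stopping yields a
  given colouring once per colour free at both \<open>p\<close> and \<open>r\<close>; the branches
  through children account for the colours free at \<open>p\<close> but used at \<open>r\<close>.
  The stopping probability \<open>(\<kappa> - l) / \<kappa>\<close> gives both kinds equal weight,
  and how many colours are free at \<open>p\<close> depends only on its degree. Two obstacles shape
  the argument. During a repair there is a conflict at the top of the part still to be repaired, so
  flips are studied under a condition on the vertices below only. And the chance of continuing is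
  conditional on all that the chain has met; instead of conditioning, sums carry an arbitrary
  nonnegative weight depending on the colours outside the subtree, and the induction multiplies it
  by one more indicator per level.\<close>

definition forest :: "'v parents \<Rightarrow> bool" where
  "forest par \<longleftrightarrow> acyclic {(y, p). par y = Some p}"

text \<open>Contains \<open>v\<close> itself. In a forest the edges inside \<open>desc par v\<close>
  are therefore those below \<open>v\<close>, while the edge from \<open>v\<close> to its parent
  only meets this set.\<close>

definition desc :: "'v parents \<Rightarrow> 'v \<Rightarrow> 'v set" where
  "desc par v = {x. ancestor par x v}"

lemma ancestor_refl [simp]: "ancestor par v v"
  by (simp add: ancestor_def)

lemma ancestor_trans: "ancestor par x y \<Longrightarrow> ancestor par y z \<Longrightarrow> ancestor par x z"
  by (auto simp: ancestor_def)

lemma ancestor_parent: "par x = Some y \<Longrightarrow> ancestor par x y"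
  by (auto simp: ancestor_def)

lemma ancestor_cases:
  assumes "ancestor par x z"
  obtains "x = z" | y where "par x = Some y" "ancestor par y z"
  using assms unfolding ancestor_def by (auto elim: converse_rtranclE)

lemma desc_self [simp]: "v \<in> desc par v"
  by (simp add: desc_def)

lemma desc_child: "par w = Some v \<Longrightarrow> desc par w \<subseteq> desc par v"
  by (auto simp: desc_def intro: ancestor_trans ancestor_parent)

lemma forest_no_return:
  assumes "forest par" "par w = Some v"
  shows "\<not> ancestor par v w"
proof
  assume "ancestor par v w"
  then have "(w, w) \<in> {(y, p). par y = Some p}\<^sup>+"
    using assms(2) unfolding ancestor_def by (auto intro: rtrancl_into_trancl2)
  with assms(1) show False by (auto simp: forest_def acyclic_def)
qed

lemma parent_notin_desc: "forest par \<Longrightarrow> par w = Some v \<Longrightarrow> v \<notin> desc par w"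
  by (simp add: desc_def forest_no_return)

lemma forest_induct [consumes 1, case_names step]:
  fixes par :: "'v::finite parents"
  assumes "forest par" and "\<And>w. (\<And>x. par x = Some w \<Longrightarrow> P x) \<Longrightarrow> P w"
  shows "P w"
proof -
  have "wf {(y, p). par y = Some p}"
    using assms(1) by (intro finite_acyclic_wf) (auto simp: forest_def)
  then show ?thesis
    by (induction w rule: wf_induct_rule) (auto intro: assms(2))
qed

lemma edgeI: "par w = Some v \<Longrightarrow> {v, w} \<in> edges par"
  by (auto simp: edges_def)

lemma edgeE:
  assumes "e \<in> edges par"
  obtains v w where "par w = Some v" "e = {v, w}"
  using assms by (auto simp: edges_def)

text \<open>A subtree is joined to the rest only by the edge above its top vertex. All claims that a
  flip or a swap of colours acts locally rest on this.\<close>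

lemma edge_meets_desc:
  assumes "e \<in> edges par" "x \<in> e" "x \<in> desc par w"
  shows "e \<subseteq> desc par w \<or> (\<exists>v. par w = Some v \<and> e = {v, w})"
proof -
  obtain a b where ab: "par b = Some a" "e = {a, b}" using assms(1) by (rule edgeE)
  consider "a \<in> desc par w" | "b \<in> desc par w" using ab assms by auto
  then show ?thesis
  proof cases
    case 1
    then have "b \<in> desc par w" using ab by (auto simp: desc_def intro: ancestor_trans ancestor_parent)
    with 1 ab show ?thesis by auto
  next
    case 2
    then have "ancestor par b w" by (simp add: desc_def)
    then show ?thesis
    proof (cases rule: ancestor_cases)
      case 1
      then show ?thesis using ab by auto
    next
      case (2 y)
      then have "a \<in> desc par w" using ab by (simp add: desc_def)
      then show ?thesis using \<open>b \<in> desc par w\<close> ab by auto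
    qed
  qed
qed

lemma edge_eq_iff:
  assumes "forest par" "par w = Some v" "par x = Some u"
  shows "{v, w} = {u, x} \<longleftrightarrow> w = x"
  using assms forest_no_return[of par w v] forest_no_return[of par x u]
  by (auto simp: doubleton_eq_iff ancestor_parent)

lemma edge_disjoint_desc:
  assumes "forest par" "par w = Some v" "par x = Some w"
  shows "{v, w} \<inter> desc par x = {}"
  using assms parent_notin_desc[of par x w]
  by (auto simp: desc_def intro: ancestor_parent ancestor_trans)

section \<open>Kempe chains\<close>

text \<open>Properness at the vertices of the subtree of \<open>w\<close> only. In the middle of a
  repair the parent of \<open>w\<close> may see the same colour on two edges, so properness
  everywhere would not be preserved.\<close>

definition separated :: "'v parents \<Rightarrow> 'v \<Rightarrow> 'v colouring \<Rightarrow> bool" where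
  "separated par w col \<longleftrightarrow> dom col = edges par \<and> (\<forall>x\<in>desc par w. inj_on col {e \<in> edges par. x \<in> e})"

text \<open>Joins the recolouring of \<open>{v, w}\<close> to the repair that it causes. Starting
  from the colouring before the conflict keeps the old colour of \<open>{v, w}\<close> readable, and
  this colour is the argument with which the same function undoes the flip.\<close>

definition kempe :: "'v parents \<Rightarrow> 'v \<Rightarrow> 'v \<Rightarrow> nat \<Rightarrow> 'v colouring \<Rightarrow> 'v colouring" where
  "kempe par v w \<gamma> col = fix_forbidden par w (the (col {v, w})) \<gamma> (col({v, w} \<mapsto> \<gamma>))"

lemma separated_eqD:
  assumes "separated par w col" "x \<in> desc par w" "x \<in> e" "x \<in> f" "col e = Some \<gamma>" "col f = Some \<gamma>"
  shows "e = f"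
proof -
  have "e \<in> edges par" "f \<in> edges par" using assms by (auto simp: separated_def)
  moreover have "inj_on col {e \<in> edges par. x \<in> e}" using assms by (simp add: separated_def)
  ultimately show ?thesis using assms inj_onD[of col "{e \<in> edges par. x \<in> e}" e f] by simp
qed

lemma separated_child:
  "separated par w col \<Longrightarrow> par x = Some w \<Longrightarrow> separated par x col"
  using desc_child[of par x w] by (auto simp: separated_def)

lemma separated_upd:
  assumes "separated par w col" "e \<in> edges par" "e \<inter> desc par w = {}"
  shows "separated par w (col(e \<mapsto> \<gamma>))"
  using assms unfolding separated_def by (auto simp: inj_on_def)

lemma kempe_stop:
  assumes "forest par" "par w = Some v" "\<And>x. par x = Some w \<Longrightarrow> col {w, x} \<noteq> Some \<gamma>"
  shows "kempe par v w \<gamma> col = col({v, w} \<mapsto> \<gamma>)"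
proof -
  have "{v, w} \<noteq> {w, x}" if "par x = Some w" for x
    using edge_eq_iff[OF assms(1,2) that] parent_notin_desc[OF assms(1) that] by auto
  then have "\<not> (\<exists>x. coloured_child par (col({v, w} \<mapsto> \<gamma>)) w \<gamma> x)"
    using assms(3) by (auto simp: coloured_child_def children_def)
  then show ?thesis unfolding kempe_def by (subst fix_forbidden.simps) auto
qed

text \<open>Uniqueness of the child replaces separation here, because the unfolding is also needed
  for a colouring with the edge \<open>{p, r}\<close> set arbitrarily, in
  \<open>kempe_link\<close>.\<close>

lemma kempe_step_unique:
  assumes "forest par" "par w = Some v" "par x = Some w" "col {w, x} = Some \<gamma>"
    and uniq: "\<And>y. par y = Some w \<Longrightarrow> col {w, y} = Some \<gamma> \<Longrightarrow> y = x"
  shows "kempe par v w \<gamma> col = kempe par w x (the (col {v, w})) (col({v, w} \<mapsto> \<gamma>))"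
proof -
  let ?c = "col({v, w} \<mapsto> \<gamma>)"
  have ne: "{v, w} \<noteq> {w, y}" if "par y = Some w" for y
    using edge_eq_iff[OF assms(1,2) that] parent_notin_desc[OF assms(1) that] by auto
  have "coloured_child par ?c w \<gamma> = (\<lambda>y. y = x)"
  proof (intro ext iffI)
    fix y
    assume y: "coloured_child par ?c w \<gamma> y"
    then have "par y = Some w" by (simp add: coloured_child_def children_def)
    with y ne[of y] uniq[of y] show "y = x" by (auto simp: coloured_child_def)
  next
    fix y assume "y = x"
    then show "coloured_child par ?c w \<gamma> y"
      using ne[OF assms(3)] assms(3,4) by (auto simp: coloured_child_def children_def)
  qed
  moreover have "?c {w, x} = Some \<gamma>" using ne[OF assms(3)] assms(4) by auto
  ultimately show ?thesis
    unfolding kempe_def by (subst fix_forbidden.simps) simp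
qed

lemma separated_child_unique:
  assumes "separated par w col" "col {w, x} = Some \<gamma>" "col {w, y} = Some \<gamma>"
  shows "y = x"
  using separated_eqD[OF assms(1), of w "{w, y}" "{w, x}" \<gamma>] assms by (auto simp: doubleton_eq_iff)

lemma kempe_step:
  assumes "forest par" "par w = Some v" "par x = Some w" "col {w, x} = Some \<gamma>" "separated par w col"
  shows "kempe par v w \<gamma> col = kempe par w x (the (col {v, w})) (col({v, w} \<mapsto> \<gamma>))"
proof (rule kempe_step_unique[of par w v x col \<gamma>])
  fix y assume "col {w, y} = Some \<gamma>"
  then show "y = x" by (rule separated_child_unique[OF assms(5,4)])
qed (fact assms)+

text \<open>One unfolding of the chain. In the second case \<open>{v, w}\<close> and
  \<open>{w, x}\<close> both carry \<open>\<gamma>\<close>, so after the recolouring separation is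
  lost at \<open>w\<close> and is claimed only from \<open>x\<close> downwards.\<close>

lemma kempe_cases:
  assumes "forest par" "par w = Some v" "separated par w col"
  obtains (stop) "\<And>x. par x = Some w \<Longrightarrow> col {w, x} \<noteq> Some \<gamma>"
      "kempe par v w \<gamma> col = col({v, w} \<mapsto> \<gamma>)"
  | (step) x where "par x = Some w" "col {w, x} = Some \<gamma>"
      "separated par x (col({v, w} \<mapsto> \<gamma>))"
      "kempe par v w \<gamma> col = kempe par w x (the (col {v, w})) (col({v, w} \<mapsto> \<gamma>))"
proof (cases "\<exists>x. par x = Some w \<and> col {w, x} = Some \<gamma>")
  case True
  then obtain x where x: "par x = Some w" "col {w, x} = Some \<gamma>" by auto
  have "separated par x (col({v, w} \<mapsto> \<gamma>))"
    using separated_child[OF assms(3) x(1)] edge_disjoint_desc[OF assms(1,2) x(1)] edgeI[of par w v, OF assms(2)]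
    by (intro separated_upd) auto
  then show ?thesis using step[OF x] kempe_step[OF assms(1,2) x assms(3)] by blast
next
  case False
  then show ?thesis using stop kempe_stop[OF assms(1,2)] by metis
qed

text \<open>A chain below \<open>w\<close> never inspects an edge that avoids the subtree, so
  recolouring such an edge commutes with the flip. This lets the edge recoloured one level higher be
  pulled out of the recursive call.\<close>

lemma kempe_upd:
  fixes par :: "'v::finite parents"
  assumes "forest par" "par w = Some v" "separated par w col" "e \<inter> desc par w = {}" "e \<in> edges par"
  shows "kempe par v w \<gamma> (col(e \<mapsto> z)) = (kempe par v w \<gamma> col)(e \<mapsto> z)"
  using assms
proof (induction w arbitrary: v \<gamma> col rule: forest_induct)
  case (step w)
  note prems = step.prems
  have evw: "e \<noteq> {v, w}" using prems(3) by auto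
  have ewx: "e \<noteq> {w, x}" for x using prems(3) by auto
  have sep: "separated par w (col(e \<mapsto> z))" using prems by (intro separated_upd) auto
  show ?case
  proof (cases rule: kempe_cases[OF assms(1) prems(1,2), of \<gamma>])
    case 1
    have "kempe par v w \<gamma> (col(e \<mapsto> z)) = col(e \<mapsto> z, {v, w} \<mapsto> \<gamma>)"
      using 1 ewx by (intro kempe_stop[OF assms(1) prems(1)]) auto
    then show ?thesis unfolding 1(2) using evw by (simp only: fun_upd_twist)
  next
    case (2 x)
    have "kempe par v w \<gamma> (col(e \<mapsto> z)) = kempe par w x (the (col {v, w})) (col(e \<mapsto> z, {v, w} \<mapsto> \<gamma>))"
      using kempe_step[OF assms(1) prems(1) 2(1) _ sep, of \<gamma>] 2(2) ewx[of x] evw by simp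
    also have "\<dots> = kempe par w x (the (col {v, w})) (col({v, w} \<mapsto> \<gamma>, e \<mapsto> z))"
      by (subst fun_upd_twist[OF evw]) (rule refl)
    also have "\<dots> = (kempe par w x (the (col {v, w})) (col({v, w} \<mapsto> \<gamma>)))(e \<mapsto> z)"
      by (rule step.IH[OF 2(1) 2(1) 2(3) _ prems(4)])
         (use prems(3) desc_child[of par x w, OF 2(1)] in blast)
    finally show ?thesis unfolding 2(4) .
  qed
qed

lemma inj_on_agree: "inj_on f A \<Longrightarrow> (\<And>a. a \<in> A \<Longrightarrow> g a = f a) \<Longrightarrow> inj_on g A"
  by (subst inj_on_cong[of A g f]) auto

lemma inj_on_overwrite:
  "inj_on f (A - {a}) \<Longrightarrow> (\<And>b. b \<in> A \<Longrightarrow> b \<noteq> a \<Longrightarrow> f b \<noteq> y) \<Longrightarrow> inj_on (f(a := y)) A"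
  by (auto simp: inj_on_def)

text \<open>The five facts are proved together by induction from the leaves: undoing the flip at
  \<open>w\<close> needs separation, the new top colour and the undoing for the shorter chain
  below.\<close>

lemma kempe_properties:
  fixes par :: "'v::finite parents"
  assumes "forest par" "par w = Some v" "separated par w col"
  shows "separated par w (kempe par v w \<gamma> col)"
    and "kempe par v w \<gamma> col {v, w} = Some \<gamma>"
    and "\<And>e. e \<inter> desc par w = {} \<Longrightarrow> kempe par v w \<gamma> col e = col e"
    and "ran (kempe par v w \<gamma> col) \<subseteq> insert \<gamma> (ran col)"
    and "kempe par v w (the (col {v, w})) (kempe par v w \<gamma> col) = col"
proof -
  have "separated par w (kempe par v w \<gamma> col) \<and> kempe par v w \<gamma> col {v, w} = Some \<gamma> \<and>
    (\<forall>e. e \<inter> desc par w = {} \<longrightarrow> kempe par v w \<gamma> col e = col e) \<and>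
    ran (kempe par v w \<gamma> col) \<subseteq> insert \<gamma> (ran col) \<and>
    kempe par v w (the (col {v, w})) (kempe par v w \<gamma> col) = col"
    using assms
  proof (induction w arbitrary: v \<gamma> col rule: forest_induct)
    case (step w)
    note pw = step.prems(1) and sep = step.prems(2)
    have vw: "{v, w} \<in> edges par" using pw by (rule edgeI)
    then obtain \<beta> where \<beta>: "col {v, w} = Some \<beta>" using sep by (auto simp: separated_def)
    have ran_upd: "ran (col({v, w} \<mapsto> \<gamma>)) \<subseteq> insert \<gamma> (ran col)"
      by (auto simp: ran_def)
    have ne: "{v, w} \<noteq> {w, x}" if "par x = Some w" for x
      using edge_eq_iff[OF assms(1) pw that] parent_notin_desc[OF assms(1) that] by auto
    have edge_at_w: "e = {v, w} \<or> (\<exists>y. par y = Some w \<and> e = {w, y})" if "e \<in> edges par" "w \<in> e" for e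
      using that pw by (auto simp: edges_def)
    have edge_at: "{v, w} \<noteq> e" if "x \<in> desc par w" "x \<noteq> w" "x \<in> e" for x e
      using that parent_notin_desc[OF assms(1) pw] by auto
    show ?case
    proof (cases rule: kempe_cases[OF assms(1) pw sep, of \<gamma>])
      case 1
      let ?c = "col({v, w} \<mapsto> \<gamma>)"
      have "inj_on ?c {e \<in> edges par. x \<in> e}" if x: "x \<in> desc par w" for x
      proof (cases "x = w")
        case True
        have "f \<in> edges par \<Longrightarrow> w \<in> f \<Longrightarrow> f \<noteq> {v, w} \<Longrightarrow> col f \<noteq> Some \<gamma>" for f
          using edge_at_w[of f] 1(1) by auto
        moreover have "inj_on col {e \<in> edges par. x \<in> e}" using sep x by (auto simp: separated_def)
        ultimately show ?thesis using True by (intro inj_on_overwrite inj_on_diff) auto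
      next
        case False
        have "inj_on col {e \<in> edges par. x \<in> e}" using sep x by (auto simp: separated_def)
        then show ?thesis by (rule inj_on_agree) (use edge_at[OF x False] in auto)
      qed
      then have "separated par w ?c" using sep vw by (auto simp: separated_def)
      \<comment> \<open>The reverse flip stops at once as well: \<open>\<beta>\<close> was the
        colour of \<open>{v, w}\<close>, so no child edge of \<open>w\<close> carries it.\<close>
      moreover have "kempe par v w \<beta> ?c = ?c({v, w} \<mapsto> \<beta>)"
      proof (rule kempe_stop[OF assms(1) pw])
        fix x assume x: "par x = Some w"
        show "?c {w, x} \<noteq> Some \<beta>"
          using separated_eqD[OF sep, of w "{v, w}" "{w, x}" \<beta>] \<beta> ne[OF x] by auto
      qed
      moreover have "?c({v, w} \<mapsto> \<beta>) = col" using \<beta> by auto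
      moreover have "?c e = col e" if "e \<inter> desc par w = {}" for e
        using that by auto
      ultimately show ?thesis unfolding 1(2) \<beta> option.sel using ran_upd by (simp del: fun_upd_apply add: fun_upd_same)
    next
      case (2 x)
      let ?c = "col({v, w} \<mapsto> \<gamma>)"
      let ?d = "kempe par w x \<beta> ?c"
      note nex = ne[OF 2(1)]
      have dj: "{v, w} \<inter> desc par x = {}" by (rule edge_disjoint_desc[OF assms(1) pw 2(1)])
      have cwx: "?c {w, x} = Some \<gamma>" using 2(2) nex by simp
      \<comment> \<open>The shorter chain gives \<open>{w, x}\<close> the colour
        \<open>\<beta>\<close>; its old colour is \<open>\<gamma>\<close>, which is the one that
        undoes it.\<close>
      from step.IH[OF 2(1) 2(1) 2(3), of \<beta>]
      have IH: "separated par x ?d" "?d {w, x} = Some \<beta>"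
          "\<And>e. e \<inter> desc par x = {} \<Longrightarrow> ?d e = ?c e"
          "ran ?d \<subseteq> insert \<beta> (ran ?c)" "kempe par w x \<gamma> ?d = ?c"
        unfolding cwx option.sel by blast+
      have dvw: "?d {v, w} = Some \<gamma>" using IH(3)[OF dj] by simp
      have keep: "?d e = col e" if "e \<in> edges par" "e \<noteq> {w, x}" "e \<noteq> {v, w}" "y \<in> e" "y \<notin> desc par x" for e y
      proof -
        have False if "z \<in> e" "z \<in> desc par x" for z
          using edge_meets_desc[OF \<open>e \<in> edges par\<close> that] \<open>y \<in> e\<close> \<open>y \<notin> desc par x\<close> \<open>e \<noteq> {w, x}\<close> 2(1)
          by auto
        then have "e \<inter> desc par x = {}" by blast
        then show ?thesis using IH(3) that by simp
      qed
      have inj: "inj_on ?d {e \<in> edges par. y \<in> e}" if y: "y \<in> desc par w" for y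
      proof (cases "y \<in> desc par x")
        case True
        then show ?thesis using IH(1) by (auto simp: separated_def)
      next
        case ynx: False
        have ic: "inj_on col {e \<in> edges par. y \<in> e}" using sep y by (auto simp: separated_def)
        show ?thesis
        proof (cases "y = w")
          case True
          \<comment> \<open>At \<open>w\<close> the edges \<open>{v, w}\<close> and
            \<open>{w, x}\<close> merely exchange \<open>\<beta>\<close> and
            \<open>\<gamma>\<close>; the remaining edges keep their colours and had neither of the
            two.\<close>
          have other: "?d f = col f \<and> col f \<noteq> Some \<beta> \<and> col f \<noteq> Some \<gamma>"
            if f: "f \<in> edges par" "w \<in> f" "f \<noteq> {v, w}" "f \<noteq> {w, x}" for f
            using keep[OF f(1,4,3,2)] ynx True separated_eqD[OF sep, of w "{v, w}" f \<beta>]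
              separated_eqD[OF sep, of w "{w, x}" f \<gamma>] f \<beta> 2 by auto
          have "\<beta> \<noteq> \<gamma>" using separated_eqD[OF sep, of w "{v, w}" "{w, x}" \<gamma>] \<beta> 2 nex by auto
          let ?S = "{e \<in> edges par. y \<in> e} - {{v, w}, {w, x}}"
          have "inj_on ?d ?S"
            using other True by (intro inj_on_agree[OF inj_on_subset[OF ic]]) auto
          moreover have "?d f \<noteq> Some \<beta> \<and> ?d f \<noteq> Some \<gamma>" if "f \<in> ?S" for f
            using other[of f] that True by simp
          ultimately have "inj_on ?d (insert {v, w} (insert {w, x} ?S))"
            using dvw IH(2) \<open>\<beta> \<noteq> \<gamma>\<close> unfolding inj_on_insert by (force simp del: fun_upd_apply)
          then show ?thesis by (rule inj_on_subset) auto
        next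
          case False
          have "?d f = col f" if f: "f \<in> edges par" "y \<in> f" for f
            using keep[OF f(1) _ _ f(2) ynx] edge_at[OF y False f(2)] f ynx False desc_self[of x par]
            by blast
          with ic show ?thesis by (intro inj_on_agree[OF ic]) simp
        qed
      qed
      have sepd: "separated par w ?d" using IH(1) inj by (auto simp: separated_def)
      \<comment> \<open>The reverse flip takes the same first step, because \<open>{w, x}\<close>
        now carries \<open>\<beta>\<close>; then \<open>kempe_upd\<close> exposes the reverse of the
        shorter chain.\<close>
      have "kempe par v w \<beta> ?d = kempe par w x \<gamma> (?d({v, w} \<mapsto> \<beta>))"
        using kempe_step[OF assms(1) pw 2(1) IH(2) sepd] dvw by simp
      also have "\<dots> = ?c({v, w} \<mapsto> \<beta>)"
        using kempe_upd[OF assms(1) 2(1) IH(1) dj vw] IH(5) by simp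
      also have "\<dots> = col" using \<beta> by auto
      finally have inv: "kempe par v w \<beta> ?d = col" .
      have out: "?d e = col e" if "e \<inter> desc par w = {}" for e
      proof -
        have "e \<inter> desc par x = {}" using that desc_child[of par x w, OF 2(1)] by blast
        moreover have "e \<noteq> {v, w}" using that by auto
        ultimately show ?thesis using IH(3)[of e] by simp
      qed
      have "ran ?d \<subseteq> insert \<gamma> (ran col)" using IH(4) ran_upd \<beta> by (auto simp: ran_def)
      then show ?thesis unfolding 2(4) \<beta> option.sel using sepd dvw inv out by simp
    qed
  qed
  then show "separated par w (kempe par v w \<gamma> col)"
    "kempe par v w \<gamma> col {v, w} = Some \<gamma>"
    "\<And>e. e \<inter> desc par w = {} \<Longrightarrow> kempe par v w \<gamma> col e = col e"
    "ran (kempe par v w \<gamma> col) \<subseteq> insert \<gamma> (ran col)"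
    "kempe par v w (the (col {v, w})) (kempe par v w \<gamma> col) = col"
    by blast+
qed

section \<open>Proper colourings of a forest\<close>

definition proper :: "nat \<Rightarrow> 'v set set \<Rightarrow> 'v colouring set" where
  "proper \<kappa> E = {col. dom col = E \<and> ran col \<subseteq> {1..\<kappa>} \<and> (\<forall>x. inj_on col {e \<in> E. x \<in> e})}"

lemma finite_proper: "finite (proper \<kappa> (E :: 'v::finite set set))"
  by (rule finite_subset[OF _ finite_set_of_finite_maps[of E "{1..\<kappa>}"]]) (auto simp: proper_def)

lemma proper_separated: "col \<in> proper \<kappa> (edges par) \<Longrightarrow> separated par w col"
  by (simp add: proper_def separated_def)

lemma proper_colour:
  assumes "col \<in> proper \<kappa> E" "e \<in> E"
  obtains \<gamma> where "col e = Some \<gamma>" "\<gamma> \<in> {1..\<kappa>}"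
  using assms by (fastforce simp: proper_def ran_def)

lemma proper_inj:
  assumes "col \<in> proper \<kappa> E" "x \<in> e" "x \<in> f" "col e = Some \<gamma>" "col f = Some \<gamma>"
  shows "e = f"
proof -
  have "e \<in> E" "f \<in> E" "inj_on col {e \<in> E. x \<in> e}" using assms by (auto simp: proper_def)
  with assms show ?thesis using inj_onD[of col "{e \<in> E. x \<in> e}" e f] by simp
qed

section \<open>The expected length of a Kempe chain\<close>

definition chain_length :: "'v parents \<Rightarrow> 'v \<Rightarrow> 'v \<Rightarrow> nat \<Rightarrow> 'v colouring \<Rightarrow> nat" where
  "chain_length par v w \<gamma> col = card {e. kempe par v w \<gamma> col e \<noteq> col e}"

text \<open>By \<open>kempe_upd\<close> the rest of the chain is a chain in the original colouring,
  started below with the two colours exchanged. At most one summand is nonzero; the sum over all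
  children is written so that each term can later be averaged separately.\<close>

lemma chain_length_le:
  fixes par :: "'v::finite parents"
  assumes "forest par" "par w = Some v" "separated par w col"
  shows "real (chain_length par v w \<gamma> col) \<le>
    1 + (\<Sum>x\<in>children par w. of_bool (col {w, x} = Some \<gamma>) * real (chain_length par w x (the (col {v, w})) col))"
proof (cases rule: kempe_cases[OF assms, of \<gamma>])
  case 1
  have "{e. kempe par v w \<gamma> col e \<noteq> col e} \<subseteq> {{v, w}}" unfolding 1(2) by auto
  from card_mono[OF _ this] have "chain_length par v w \<gamma> col \<le> 1" by (simp add: chain_length_def)
  then show ?thesis by (intro add_increasing2 sum_nonneg) auto
next
  case (2 x)
  let ?\<beta> = "the (col {v, w})"
  have "kempe par v w \<gamma> col = (kempe par w x ?\<beta> col)({v, w} \<mapsto> \<gamma>)"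
    unfolding 2(4)
    using assms 2 separated_child[of par w col x] edge_disjoint_desc[of par w v x] edgeI[of par w v]
    by (intro kempe_upd) auto
  then have "{e. kempe par v w \<gamma> col e \<noteq> col e} \<subseteq> insert {v, w} {e. kempe par w x ?\<beta> col e \<noteq> col e}"
    by auto
  from card_mono[OF _ this] have "chain_length par v w \<gamma> col \<le> 1 + chain_length par w x ?\<beta> col"
    unfolding chain_length_def using card_insert_if[of "{e. kempe par w x ?\<beta> col e \<noteq> col e}" "{v, w}"]
    by (simp split: if_splits)
  moreover have "real (chain_length par w x ?\<beta> col) \<le>
      (\<Sum>x\<in>children par w. of_bool (col {w, x} = Some \<gamma>) * real (chain_length par w x ?\<beta> col))"
    using 2 member_le_sum[of x "children par w" "\<lambda>x. of_bool (col {w, x} = Some \<gamma>) * real (chain_length par w x ?\<beta> col)"]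
    by (simp add: children_def)
  ultimately show ?thesis by linarith
qed

text \<open>\<open>f\<close> is a function of the colours outside the subtree. In a forest the edge
  above \<open>w\<close> counts as outside, so \<open>f\<close> may record its colour.\<close>

definition invariant_below :: "'v parents \<Rightarrow> 'v \<Rightarrow> ('v colouring \<Rightarrow> real) \<Rightarrow> bool" where
  "invariant_below par w f \<longleftrightarrow>
     (\<forall>c c'. (\<forall>e. \<not> e \<subseteq> desc par w \<longrightarrow> c e = c' e) \<longrightarrow> f c = f c')"

definition swap_below :: "'v parents \<Rightarrow> 'v \<Rightarrow> nat \<Rightarrow> nat \<Rightarrow> 'v colouring \<Rightarrow> 'v colouring" where
  "swap_below par w \<gamma> \<gamma>' c e = (if e \<subseteq> desc par w then map_option (Transposition.transpose \<gamma> \<gamma>') (c e) else c e)"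

lemma swap_below_involutory: "swap_below par w \<gamma> \<gamma>' (swap_below par w \<gamma> \<gamma>' c) = c"
  by (rule ext) (simp add: swap_below_def option.map_comp comp_def option.map_ident)

text \<open>Applying one permutation to all edges below \<open>w\<close> can create a conflict only
  at \<open>w\<close>, against the edge \<open>{v, w}\<close>. Its colour \<open>\<beta>\<close> is
  fixed by the transposition, so an edge below still avoids it.\<close>

lemma swap_below_proper:
  assumes "forest par" "par w = Some v" "{\<gamma>, \<gamma>'} \<subseteq> {1..\<kappa>} - {\<beta>}"
    and "c \<in> proper \<kappa> (edges par)" "c {v, w} = Some \<beta>"
  shows "swap_below par w \<gamma> \<gamma>' c \<in> proper \<kappa> (edges par)"
proof -
  let ?c = "swap_below par w \<gamma> \<gamma>' c"
  have tr: "Transposition.transpose \<gamma> \<gamma>' \<delta> \<in> {1..\<kappa>}" if "\<delta> \<in> {1..\<kappa>}" for \<delta>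
    using that assms(3) by (auto simp: Transposition.transpose_def)
  have dom: "dom ?c = edges par"
    using assms(4) by (auto simp: swap_below_def proper_def dom_def split: if_splits)
  have "\<delta> \<in> {1..\<kappa>}" if "?c e = Some \<delta>" for e \<delta>
  proof -
    have "e \<in> edges par" using dom that by auto
    then obtain \<delta>' where "c e = Some \<delta>'" "\<delta>' \<in> {1..\<kappa>}" by (rule proper_colour[OF assms(4)])
    with that tr[of \<delta>'] show ?thesis by (auto simp: swap_below_def split: if_splits)
  qed
  then have ran: "ran ?c \<subseteq> {1..\<kappa>}" unfolding ran_def by blast
  have mixed: "?c e \<noteq> ?c f"
    if "e \<in> edges par" "f \<in> edges par" "x \<in> e" "x \<in> f" "e \<subseteq> desc par w" "\<not> f \<subseteq> desc par w" for e f x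
  proof -
    have "f = {v, w}" using edge_meets_desc[OF that(2,4), of w] that assms(2) by auto
    then have cf: "?c f = Some \<beta>" using assms(5) that(6) by (simp add: swap_below_def)
    obtain \<delta> where \<delta>: "c e = Some \<delta>" using proper_colour[OF assms(4) \<open>e \<in> edges par\<close>] by blast
    have "\<delta> \<noteq> \<beta>"
      using proper_inj[OF assms(4) that(3,4) \<delta>] assms(5) \<open>f = {v, w}\<close> that(5,6) by auto
    then have "Transposition.transpose \<gamma> \<gamma>' \<delta> \<noteq> \<beta>" using assms(3) by (auto simp: Transposition.transpose_def)
    with cf \<delta> that(5) show ?thesis by (simp add: swap_below_def)
  qed
  have "inj_on ?c {e \<in> edges par. x \<in> e}" for x
  proof (rule inj_onI)
    fix e f assume e: "e \<in> {e \<in> edges par. x \<in> e}" and f: "f \<in> {e \<in> edges par. x \<in> e}" and eq: "?c e = ?c f"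
    then have iff: "e \<subseteq> desc par w \<longleftrightarrow> f \<subseteq> desc par w" using mixed[of e f x] mixed[of f e x] by auto
    obtain \<delta> where \<delta>: "c e = Some \<delta>" using proper_colour[OF assms(4)] e by blast
    obtain \<delta>' where \<delta>': "c f = Some \<delta>'" using proper_colour[OF assms(4)] f by blast
    have "\<delta> = \<delta>'"
      using eq iff \<delta> \<delta>' by (cases "f \<subseteq> desc par w") (auto simp: swap_below_def dest: injD[OF inj_transpose])
    then show "e = f" using proper_inj[OF assms(4), of x e f \<delta>] e f \<delta> \<delta>' by simp
  qed
  with dom ran show ?thesis by (simp add: proper_def)
qed

lemma sum_swap_below:
  fixes par :: "'v::finite parents"
  assumes "forest par" "par w = Some v" "par x = Some w" "{\<gamma>, \<gamma>'} \<subseteq> {1..\<kappa>} - {\<beta>}"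
    and inv: "invariant_below par w f" and supp: "\<And>c. f c \<noteq> 0 \<Longrightarrow> c {v, w} = Some \<beta>"
  shows "(\<Sum>c\<in>proper \<kappa> (edges par). f c * of_bool (c {w, x} = Some \<gamma>)) =
         (\<Sum>c\<in>proper \<kappa> (edges par). f c * of_bool (c {w, x} = Some \<gamma>'))"
proof -
  let ?\<Omega> = "proper \<kappa> (edges par)" and ?S = "{c \<in> proper \<kappa> (edges par). c {v, w} = Some \<beta>}"
  let ?T = "swap_below par w \<gamma> \<gamma>'"
  have vw: "\<not> {v, w} \<subseteq> desc par w" using parent_notin_desc[OF assms(1,2)] by simp
  have wx: "{w, x} \<subseteq> desc par w" using desc_child[of par x w] desc_self[of x par] assms(3) by auto
  have T: "?T c \<in> ?S" if "c \<in> ?S" for c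
    using that swap_below_proper[OF assms(1,2,4)] vw by (auto simp: swap_below_def)
  have fT: "f (?T c) = f c" for c
    using inv unfolding invariant_below_def by (auto simp: swap_below_def)
  have colT: "?T c {w, x} = Some \<gamma>' \<longleftrightarrow> c {w, x} = Some \<gamma>" for c
    using wx by (cases "c {w, x}") (auto simp: swap_below_def Transposition.transpose_def split: if_splits)
  have "(\<Sum>c\<in>?\<Omega>. f c * of_bool (c {w, x} = Some \<gamma>)) = (\<Sum>c\<in>?S. f c * of_bool (c {w, x} = Some \<gamma>))"
    using supp by (intro sum.mono_neutral_right finite_proper) auto
  also have "\<dots> = (\<Sum>c\<in>?S. f c * of_bool (c {w, x} = Some \<gamma>'))"
    using T fT colT
    by (intro sum.reindex_bij_witness[where i = ?T and j = ?T]) (auto simp: swap_below_involutory)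
  also have "\<dots> = (\<Sum>c\<in>?\<Omega>. f c * of_bool (c {w, x} = Some \<gamma>'))"
    using supp by (intro sum.mono_neutral_left finite_proper) auto
  finally show ?thesis .
qed

text \<open>The edge \<open>{w, x}\<close> has one of the \<open>\<kappa> - 1\<close> colours other
  than \<open>\<beta>\<close>, and swapping below \<open>w\<close> shows that all of them have the
  same weight. This is the continuation probability \<open>1 / (\<kappa> - 1)\<close>, without any
  division by the probability of an event.\<close>

lemma sum_child_colour:
  fixes par :: "'v::finite parents"
  assumes "forest par" "par w = Some v" "par x = Some w" "\<beta> \<in> {1..\<kappa>}" "\<gamma> \<in> {1..\<kappa>}" "\<beta> \<noteq> \<gamma>"
    and inv: "invariant_below par w f" and supp: "\<And>c. f c \<noteq> 0 \<Longrightarrow> c {v, w} = Some \<beta>"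
  shows "real (\<kappa> - 1) * (\<Sum>c\<in>proper \<kappa> (edges par). f c * of_bool (c {w, x} = Some \<gamma>)) =
         (\<Sum>c\<in>proper \<kappa> (edges par). f c)"
proof -
  let ?\<Omega> = "proper \<kappa> (edges par)"
  have "f c = (\<Sum>\<gamma>'\<in>{1..\<kappa>} - {\<beta>}. f c * of_bool (c {w, x} = Some \<gamma>'))" if c: "c \<in> ?\<Omega>" for c
  proof (cases "f c = 0")
    case False
    then have "c {v, w} = Some \<beta>" by (rule supp)
    obtain \<delta> where \<delta>: "c {w, x} = Some \<delta>" "\<delta> \<in> {1..\<kappa>}" using proper_colour[OF c] edgeI assms(3) by metis
    have "\<delta> \<noteq> \<beta>"
    proof
      assume "\<delta> = \<beta>"
      then have "{v, w} = {w, x}"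
        using proper_inj[OF c, of w "{v, w}" "{w, x}" \<beta>] \<delta> \<open>c {v, w} = Some \<beta>\<close> by simp
      then show False
        using edge_eq_iff[OF assms(1,2,3)] parent_notin_desc[OF assms(1,3)] by auto
    qed
    then have "(\<Sum>\<gamma>'\<in>{1..\<kappa>} - {\<beta>}. f c * of_bool (c {w, x} = Some \<gamma>')) = (\<Sum>\<gamma>'\<in>{\<delta>}. f c)"
      using \<delta> by (intro sum.mono_neutral_cong_right) auto
    then show ?thesis by simp
  qed simp
  then have "(\<Sum>c\<in>?\<Omega>. f c) = (\<Sum>c\<in>?\<Omega>. \<Sum>\<gamma>'\<in>{1..\<kappa>} - {\<beta>}. f c * of_bool (c {w, x} = Some \<gamma>'))"
    by (intro sum.cong) auto
  also have "\<dots> = (\<Sum>\<gamma>'\<in>{1..\<kappa>} - {\<beta>}. \<Sum>c\<in>?\<Omega>. f c * of_bool (c {w, x} = Some \<gamma>'))"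
    by (rule sum.swap)
  also have "\<dots> = (\<Sum>\<gamma>'\<in>{1..\<kappa>} - {\<beta>}. \<Sum>c\<in>?\<Omega>. f c * of_bool (c {w, x} = Some \<gamma>))"
    using assms by (intro sum.cong refl sum_swap_below[where v = v and \<beta> = \<beta>]) auto
  also have "\<dots> = real (\<kappa> - 1) * (\<Sum>c\<in>?\<Omega>. f c * of_bool (c {w, x} = Some \<gamma>))"
    using assms(4) by simp
  finally show ?thesis by simp
qed

text \<open>The weight \<open>f\<close> stands for the past of the chain. One level down it is
  multiplied by the indicator that \<open>{w, x}\<close> has colour \<open>\<gamma>\<close>, which
  is again determined outside the subtree of \<open>x\<close>, and \<open>\<beta>\<close> and
  \<open>\<gamma>\<close> exchange roles.\<close>

lemma expected_chain_length:
  fixes par :: "'v::finite parents"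
  assumes "forest par" and R: "\<And>w. par w \<noteq> None \<Longrightarrow> 1 + (\<Sum>x\<in>children par w. R x) / real (\<kappa> - 1) \<le> R w"
    and "par w = Some v" "\<beta> \<in> {1..\<kappa>}" "\<gamma> \<in> {1..\<kappa>}" "\<beta> \<noteq> \<gamma>"
    and "invariant_below par w f" "\<And>c. f c \<noteq> 0 \<Longrightarrow> c {v, w} = Some \<beta>" "\<And>c. f c \<ge> 0"
  shows "(\<Sum>c\<in>proper \<kappa> (edges par). f c * real (chain_length par v w \<gamma> c)) \<le>
         R w * (\<Sum>c\<in>proper \<kappa> (edges par). f c)"
  using assms(1,3-)
proof (induction w arbitrary: v \<beta> \<gamma> f rule: forest_induct)
  case (step w)
  let ?\<Omega> = "proper \<kappa> (edges par)"
  let ?F = "\<Sum>c\<in>?\<Omega>. f c"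
  let ?g = "\<lambda>x c. f c * of_bool (c {w, x} = Some \<gamma>)"
  note prems = step.prems
  have "2 \<le> \<kappa>" using prems(2-4) by auto
  have F: "?F \<ge> 0" using prems by (intro sum_nonneg) auto
  have child: "(\<Sum>c\<in>?\<Omega>. ?g x c * real (chain_length par w x \<beta> c)) \<le> R x * (?F / real (\<kappa> - 1))"
    if x: "par x = Some w" for x
  proof -
    have "invariant_below par x (?g x)"
      unfolding invariant_below_def
    proof (intro allI impI)
      fix c c' :: "'v colouring" assume c: "\<forall>e. \<not> e \<subseteq> desc par x \<longrightarrow> c e = c' e"
      then have "f c = f c'"
        using prems(5) desc_child[of par x w] x unfolding invariant_below_def by blast
      moreover have "c {w, x} = c' {w, x}" using c parent_notin_desc[OF assms(1) x] by auto
      ultimately show "?g x c = ?g x c'" by simp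
    qed
    then have "(\<Sum>c\<in>?\<Omega>. ?g x c * real (chain_length par w x \<beta> c)) \<le> R x * (\<Sum>c\<in>?\<Omega>. ?g x c)"
      using prems x by (intro step.IH[where \<beta> = \<gamma>]) auto
    moreover have "real (\<kappa> - 1) * (\<Sum>c\<in>?\<Omega>. ?g x c) = ?F"
      by (rule sum_child_colour[OF assms(1) prems(1) x prems(2-5)]) (rule prems(6))
    then have "(\<Sum>c\<in>?\<Omega>. ?g x c) = ?F / real (\<kappa> - 1)"
      using \<open>2 \<le> \<kappa>\<close> by (simp add: eq_divide_eq mult.commute)
    ultimately show ?thesis by simp
  qed
  have "(\<Sum>c\<in>?\<Omega>. f c * real (chain_length par v w \<gamma> c)) \<le>
      (\<Sum>c\<in>?\<Omega>. f c * (1 + (\<Sum>x\<in>children par w. of_bool (c {w, x} = Some \<gamma>) * real (chain_length par w x \<beta> c))))"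
  proof (rule sum_mono)
    fix c assume c: "c \<in> ?\<Omega>"
    show "f c * real (chain_length par v w \<gamma> c) \<le>
      f c * (1 + (\<Sum>x\<in>children par w. of_bool (c {w, x} = Some \<gamma>) * real (chain_length par w x \<beta> c)))"
    proof (cases "f c = 0")
      case False
      then have "the (c {v, w}) = \<beta>" using prems(6)[of c] by simp
      then show ?thesis
        using chain_length_le[OF assms(1) prems(1) proper_separated[OF c], of \<gamma>] prems(7)[of c]
        by (intro mult_left_mono) auto
    qed simp
  qed
  also have "\<dots> = ?F + (\<Sum>c\<in>?\<Omega>. \<Sum>x\<in>children par w. ?g x c * real (chain_length par w x \<beta> c))"
    by (simp only: distrib_left sum.distrib sum_distrib_left mult.assoc mult_1_right)
  also have "(\<Sum>c\<in>?\<Omega>. \<Sum>x\<in>children par w. ?g x c * real (chain_length par w x \<beta> c)) =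
      (\<Sum>x\<in>children par w. \<Sum>c\<in>?\<Omega>. ?g x c * real (chain_length par w x \<beta> c))"
    by (rule sum.swap)
  also have "\<dots> \<le> (\<Sum>x\<in>children par w. R x * (?F / real (\<kappa> - 1)))"
    using child by (intro sum_mono) (auto simp: children_def)
  also have "?F + \<dots> = ?F * (1 + (\<Sum>x\<in>children par w. R x) / real (\<kappa> - 1))"
    by (simp add: sum_distrib_right[symmetric] sum_divide_distrib[symmetric] distrib_left)
  also have "\<dots> \<le> ?F * R w"
    using R[of w] prems(1) F by (intro mult_left_mono) auto
  finally show ?case by (simp add: mult.commute)
qed

section \<open>Effect of one additional edge on forest, free colours and flips\<close>

lemma edges_link:
  assumes "par r = None"
  shows "edges (par(r \<mapsto> p)) = insert {p, r} (edges par)"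
proof (intro equalityI subsetI)
  fix e assume "e \<in> edges (par(r \<mapsto> p))"
  then show "e \<in> insert {p, r} (edges par)" by (auto simp: edges_def split: if_splits)
next
  fix e assume "e \<in> insert {p, r} (edges par)"
  then consider "e = {p, r}" | v w where "par w = Some v" "e = {v, w}" by (auto elim: edgeE)
  then show "e \<in> edges (par(r \<mapsto> p))"
  proof cases
    case 2
    then show ?thesis using assms edgeI[of "par(r \<mapsto> p)" w v] by (cases "w = r") auto
  qed (simp add: edgeI)
qed

lemma link_notin_edges:
  assumes "par r = None" "\<not> ancestor par p r"
  shows "{p, r} \<notin> edges par"
  using assms ancestor_parent[of par p r] by (auto simp: edges_def doubleton_eq_iff)

lemma forest_link:
  assumes "forest par" "par r = None" "\<not> ancestor par p r"
  shows "forest (par(r \<mapsto> p))"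
proof -
  have "{(y, q). (par(r \<mapsto> p)) y = Some q} = insert (r, p) {(y, q). par y = Some q}"
    using assms(2) by (auto split: if_splits)
  then show ?thesis using assms unfolding forest_def ancestor_def by (auto simp: acyclic_insert)
qed

lemma available_cong:
  assumes "\<And>e. x \<in> e \<Longrightarrow> c e = c' e"
  shows "available \<kappa> c x = available \<kappa> c' x"
  using assms by (auto simp: available_def)

text \<open>Colours at a vertex are distinct, so the number of free ones depends on the degree
  alone. Uniform choices of a free colour therefore have the same probabilities under every proper
  colouring.\<close>

lemma card_available:
  assumes "c \<in> proper \<kappa> E" "finite E"
  shows "card (available \<kappa> c x) = \<kappa> - degree E x"
proof -
  let ?S = "{e \<in> E. x \<in> e}"
  have "{\<gamma>. \<exists>e. x \<in> e \<and> c e = Some \<gamma>} = (\<lambda>e. the (c e)) ` ?S"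
    using assms(1) by (force simp: proper_def dom_def)
  moreover have "inj_on (\<lambda>e. the (c e)) ?S"
  proof (rule inj_onI)
    fix e f assume e: "e \<in> ?S" and f: "f \<in> ?S" and eq: "the (c e) = the (c f)"
    obtain \<gamma> where \<gamma>: "c e = Some \<gamma>" using proper_colour[OF assms(1)] e by blast
    obtain \<delta> where \<delta>: "c f = Some \<delta>" using proper_colour[OF assms(1)] f by blast
    show "e = f" using proper_inj[OF assms(1), of x e f \<gamma>] e f \<gamma> \<delta> eq by simp
  qed
  moreover have "(\<lambda>e. the (c e)) ` ?S \<subseteq> {1..\<kappa>}"
  proof
    fix \<gamma> assume "\<gamma> \<in> (\<lambda>e. the (c e)) ` ?S"
    then obtain e where "e \<in> E" "\<gamma> = the (c e)" by auto
    with proper_colour[OF assms(1)] show "\<gamma> \<in> {1..\<kappa>}" by (metis option.sel)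
  qed
  ultimately show ?thesis
    using assms(2) by (simp add: available_def degree_def card_Diff_subset card_image)
qed

lemma proper_insert_edge:
  assumes "c \<in> proper \<kappa> E" "\<beta> \<in> available \<kappa> c p" "\<beta> \<in> available \<kappa> c r"
  shows "c({p, r} \<mapsto> \<beta>) \<in> proper \<kappa> (insert {p, r} E)"
proof -
  let ?c = "c({p, r} \<mapsto> \<beta>)"
  have "inj_on ?c {e \<in> insert {p, r} E. x \<in> e}" for x
  proof (cases "x \<in> {p, r}")
    case True
    have "inj_on c {e \<in> E. x \<in> e}" using assms(1) by (simp add: proper_def)
    moreover have "c e \<noteq> Some \<beta>" if "x \<in> e" for e
      using assms(2,3) True that by (auto simp: available_def)
    ultimately show ?thesis
      by (intro inj_on_overwrite) (auto elim: inj_on_subset)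
  next
    case False
    have "inj_on c {e \<in> E. x \<in> e}" using assms(1) by (simp add: proper_def)
    moreover have "{e \<in> insert {p, r} E. x \<in> e} = {e \<in> E. x \<in> e}" using False by auto
    ultimately show ?thesis using False by (auto simp: inj_on_def)
  qed
  moreover have "dom ?c = insert {p, r} E" using assms(1) by (auto simp: proper_def)
  moreover have "ran ?c \<subseteq> {1..\<kappa>}"
    using assms(1,2) by (auto simp: proper_def available_def ran_def)
  ultimately show ?thesis by (simp add: proper_def)
qed

lemma proper_delete_edge:
  assumes "c \<in> proper \<kappa> (insert e E)" "e \<notin> E"
  shows "c(e := None) \<in> proper \<kappa> E"
proof -
  have "inj_on (c(e := None)) {f \<in> E. x \<in> f}" for x
  proof (rule inj_on_agree[of c])
    have "inj_on c {f \<in> insert e E. x \<in> f}" using assms(1) by (simp only: proper_def mem_Collect_eq)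
    then show "inj_on c {f \<in> E. x \<in> f}" by (rule inj_on_subset) auto
  qed (use assms(2) in auto)
  moreover have "dom (c(e := None)) = E" using assms by (auto simp: proper_def)
  moreover have "ran (c(e := None)) \<subseteq> {1..\<kappa>}"
    using assms(1) by (auto simp: proper_def ran_def)
  ultimately show ?thesis by (simp add: proper_def)
qed

lemma available_delete_edge:
  assumes "c \<in> proper \<kappa> (insert e E)" "x \<in> e"
  shows "the (c e) \<in> available \<kappa> (c(e := None)) x"
proof -
  obtain \<gamma> where \<gamma>: "c e = Some \<gamma>" "\<gamma> \<in> {1..\<kappa>}" using proper_colour[OF assms(1)] by blast
  have "f = e" if "x \<in> f" "c f = Some \<gamma>" for f
    using proper_inj[OF assms(1) that(1) assms(2) that(2) \<gamma>(1)] .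
  with \<gamma> show ?thesis by (auto simp: available_def split: if_splits)
qed

text \<open>The algorithm repairs an insertion after linking, whereas the bijection concerns the
  forest before linking. The two flips agree because \<open>p\<close> is outside the subtree of
  \<open>w\<close>, so the chain never meets the new edge.\<close>

lemma kempe_link:
  fixes par :: "'v::finite parents"
  assumes "forest par" "par r = None" "\<not> ancestor par p r"
    and "par w = Some v" "separated par w c" "p \<notin> desc par w"
  shows "kempe (par(r \<mapsto> p)) v w \<gamma> (c({p, r} := z)) = (kempe par v w \<gamma> c)({p, r} := z)"
  using assms(1,4-)
proof (induction w arbitrary: v \<gamma> c rule: forest_induct)
  case (step w)
  note prems = step.prems
  let ?par = "par(r \<mapsto> p)"
  have F: "forest ?par" by (rule forest_link[OF assms(1-3)])
  have rw: "r \<noteq> w" "p \<noteq> w" using prems assms(2) by auto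
  have pw: "?par w = Some v" using prems(1) rw by simp
  have ch: "?par x = Some w \<longleftrightarrow> par x = Some w" for x using rw assms(2) by auto
  have ne: "{w, x} \<noteq> {p, r}" for x using rw by (auto simp: doubleton_eq_iff)
  have ne': "{v, w} \<noteq> {p, r}" using rw by (auto simp: doubleton_eq_iff)
  show ?case
  proof (cases rule: kempe_cases[OF assms(1) prems(1,2), of \<gamma>])
    case 1
    have "kempe ?par v w \<gamma> (c({p, r} := z)) = c({p, r} := z, {v, w} \<mapsto> \<gamma>)"
      by (rule kempe_stop[OF F pw]) (use 1(1) ch ne in simp)
    then show ?thesis unfolding 1(2) fun_upd_twist[OF ne'] .
  next
    case (2 x)
    have "kempe ?par v w \<gamma> (c({p, r} := z)) =
        kempe ?par w x (the ((c({p, r} := z)) {v, w})) (c({p, r} := z, {v, w} \<mapsto> \<gamma>))"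
    proof (rule kempe_step_unique[OF F pw])
      show "?par x = Some w" using 2(1) ch by simp
      show "(c({p, r} := z)) {w, x} = Some \<gamma>" using 2(2) ne[of x] by simp
      fix y assume "?par y = Some w" "(c({p, r} := z)) {w, y} = Some \<gamma>"
      then show "y = x"
        using separated_child_unique[OF prems(2) 2(2)] ne[of y] by simp
    qed
    also have "\<dots> = kempe ?par w x (the (c {v, w})) (c({v, w} \<mapsto> \<gamma>, {p, r} := z))"
      by (subst fun_upd_twist[OF ne'[symmetric]]) (simp add: ne' fun_upd_other del: fun_upd_apply)
    also have "\<dots> = (kempe par w x (the (c {v, w})) (c({v, w} \<mapsto> \<gamma>)))({p, r} := z)"
      by (rule step.IH[OF 2(1) 2(1) 2(3)]) (use prems(3) desc_child[of par x w, OF 2(1)] in blast)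
    finally show ?thesis unfolding 2(4) .
  qed
qed

lemma degree_root:
  fixes par :: "'v::finite parents"
  assumes "par r = None"
  shows "degree (edges par) r = card (children par r)"
proof -
  have "{e \<in> edges par. r \<in> e} = (\<lambda>w. {r, w}) ` children par r"
    using assms by (auto simp: edges_def children_def)
  moreover have "inj_on (\<lambda>w. {r, w}) (children par r)"
    by (auto simp: inj_on_def doubleton_eq_iff)
  ultimately show ?thesis by (simp add: degree_def card_image)
qed

section \<open>Linking and cutting\<close>

text \<open>\<open>par\<close> is always the forest without \<open>{p, r}\<close>: an insertion
  starts from it and a deletion leads back to it, so both are analysed over the same pairs. The
  strict degree bounds leave a free colour at \<open>p\<close> and at \<open>r\<close>.\<close>

locale edge_update =
  fixes par :: "'v::finite parents" and p r :: 'v and \<kappa> :: nat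
  assumes forest: "forest par" and root: "par r = None" and fresh: "\<not> ancestor par p r"
    and deg_p: "degree (edges par) p < \<kappa>" and deg_r: "degree (edges par) r < \<kappa>"
begin

abbreviation "colourings \<equiv> proper \<kappa> (edges par)"
abbreviation "linked \<equiv> proper \<kappa> (insert {p, r} (edges par))"
abbreviation "free c x \<equiv> available \<kappa> c x"
abbreviation "kids \<equiv> children par r"
abbreviation "dp \<equiv> real \<kappa> - real (degree (edges par) p)"
abbreviation "dr \<equiv> real \<kappa> - real (card kids)"

text \<open>
  An insertion whose chain starts with the child edge \<open>{r, w}\<close> is given by the old colouring and the
  new colour of \<open>{r, w}\<close>, the colour of \<open>{p, r}\<close> being the old colour of \<open>{r, w}\<close>. A deletion is
  given by the colouring without \<open>{p, r}\<close> and the colour of \<open>{p, r}\<close>.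
\<close>

definition "pre_link w = {(c, \<alpha>). c \<in> colourings \<and> the (c {r, w}) \<in> free c p \<and> \<alpha> \<in> free c r}"
definition "pre_cut = {(c, \<beta>). c \<in> colourings \<and> \<beta> \<in> free c p \<inter> free c r}"

lemma pr_notin: "{p, r} \<notin> edges par"
  using link_notin_edges root fresh by metis

lemma finite_free [simp]: "finite (free c x)"
  by (simp add: available_def)

lemma finite_colourings [simp]: "finite colourings" "finite linked"
  by (rule finite_proper)+

lemma card_free_p: "c \<in> colourings \<Longrightarrow> real (card (free c p)) = dp"
  using deg_p by (simp add: card_available of_nat_diff)

lemma card_free_r: "c \<in> colourings \<Longrightarrow> real (card (free c r)) = dr"
  using deg_r root by (simp add: card_available of_nat_diff degree_root)

lemma dp_pos: "dp > 0" and dr_pos: "dr > 0"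
  using deg_p deg_r root by (auto simp: degree_root)

lemma sum_pre_link:
  "(\<Sum>(c, \<alpha>)\<in>pre_link w. g c \<alpha>) =
     (\<Sum>c\<in>colourings. of_bool (the (c {r, w}) \<in> free c p) * (\<Sum>\<alpha>\<in>free c r. g c \<alpha> :: real))"
proof -
  have "pre_link w = Sigma {c \<in> colourings. the (c {r, w}) \<in> free c p} (\<lambda>c. free c r)"
    by (auto simp: pre_link_def)
  then show ?thesis
    by (simp add: sum.Sigma[symmetric] sum.inter_filter[symmetric]) (intro sum.cong, auto)
qed

lemma sum_pre_cut:
  "(\<Sum>(c, \<beta>)\<in>pre_cut. g c \<beta>) = (\<Sum>c\<in>colourings. \<Sum>\<beta>\<in>free c p \<inter> free c r. g c \<beta> :: real)"
proof -
  have "pre_cut = Sigma colourings (\<lambda>c. free c p \<inter> free c r)" by (auto simp: pre_cut_def)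
  then show ?thesis by (simp add: sum.Sigma)
qed

lemma sum_linked:
  "(\<Sum>c\<in>linked. g c) = (\<Sum>(c, \<beta>)\<in>pre_cut. g (c({p, r} \<mapsto> \<beta>)) :: real)"
proof (rule sum.reindex_bij_witness[where i = "\<lambda>(c, \<beta>). c({p, r} \<mapsto> \<beta>)"
      and j = "\<lambda>c. (c({p, r} := None), the (c {p, r}))"])
  fix c assume c: "c \<in> linked"
  obtain \<gamma> where "c {p, r} = Some \<gamma>" using proper_colour[OF c, of "{p, r}"] by blast
  then show eq: "(case (c({p, r} := None), the (c {p, r})) of (c, \<beta>) \<Rightarrow> c({p, r} \<mapsto> \<beta>)) = c" by auto
  show "(c({p, r} := None), the (c {p, r})) \<in> pre_cut"
    using proper_delete_edge[OF c pr_notin] available_delete_edge[OF c, of p] available_delete_edge[OF c, of r]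
    by (auto simp: pre_cut_def)
  show "(case (c({p, r} := None), the (c {p, r})) of (c, \<beta>) \<Rightarrow> g (c({p, r} \<mapsto> \<beta>))) = g c"
    using eq by simp
next
  fix x assume "x \<in> pre_cut"
  then obtain c \<beta> where x: "x = (c, \<beta>)" "c \<in> colourings" "\<beta> \<in> free c p" "\<beta> \<in> free c r"
    by (auto simp: pre_cut_def)
  have "c {p, r} = None" using x(2) pr_notin by (auto simp: proper_def)
  then have "c({p, r} := None) = c" by auto
  then show "((case x of (c, \<beta>) \<Rightarrow> c({p, r} \<mapsto> \<beta>))({p, r} := None), the ((case x of (c, \<beta>) \<Rightarrow> c({p, r} \<mapsto> \<beta>)) {p, r})) = x"
    using x by simp
  show "(case x of (c, \<beta>) \<Rightarrow> c({p, r} \<mapsto> \<beta>)) \<in> linked"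
    using proper_insert_edge[OF x(2-4)] x(1) by simp
qed

context
  fixes w assumes w: "w \<in> kids"
begin

lemma par_w: "par w = Some r"
  using w by (simp add: children_def)

lemma rw_edge: "{r, w} \<in> edges par"
  using par_w by (rule edgeI)

lemma p_notin_desc: "p \<notin> desc par w"
  using fresh par_w by (auto simp: desc_def dest: ancestor_trans[OF _ ancestor_parent])

lemma r_notin_desc: "r \<notin> desc par w"
  by (rule parent_notin_desc[OF forest par_w])

lemma kempe_other:
  assumes "c \<in> colourings" "x \<in> e" "x \<notin> desc par w" "e \<noteq> {r, w}"
  shows "kempe par r w \<alpha> c e = c e"
proof (cases "e \<in> edges par")
  case True
  have False if "z \<in> e" "z \<in> desc par w" for z
    using edge_meets_desc[OF True that] assms par_w by auto
  then have "e \<inter> desc par w = {}" by blast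
  then show ?thesis by (rule kempe_properties(3)[OF forest par_w proper_separated[OF assms(1)]])
next
  case False
  have "dom (kempe par r w \<alpha> c) = edges par" "dom c = edges par"
    using kempe_properties(1)[OF forest par_w proper_separated[OF assms(1)]] assms(1)
    by (auto simp: separated_def proper_def)
  with False show ?thesis by (metis domIff)
qed

text \<open>Inside the subtree separation suffices; at \<open>r\<close> only \<open>{r, w}\<close>
  changes, to a colour that was free there; at any other vertex no edge changes.\<close>

lemma kempe_proper:
  assumes c: "c \<in> colourings" and \<alpha>: "\<alpha> \<in> free c r"
  shows "kempe par r w \<alpha> c \<in> colourings"
proof -
  let ?c = "kempe par r w \<alpha> c"
  note K = kempe_properties[OF forest par_w proper_separated[OF c], where \<gamma> = \<alpha>]
  have "inj_on ?c {e \<in> edges par. x \<in> e}" for x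
  proof (cases "x \<in> desc par w")
    case True
    then show ?thesis using K(1) by (simp add: separated_def)
  next
    case False
    have inj: "inj_on c {e \<in> edges par. x \<in> e}" using c by (simp add: proper_def)
    show ?thesis
    proof (cases "x = r")
      case True
      have "inj_on (c({r, w} \<mapsto> \<alpha>)) {e \<in> edges par. x \<in> e}"
        using inj by (intro inj_on_overwrite inj_on_diff) (use \<alpha> True in \<open>auto simp: available_def\<close>)
      then show ?thesis
      proof (rule inj_on_agree)
        fix e assume "e \<in> {e \<in> edges par. x \<in> e}"
        then show "?c e = (c({r, w} \<mapsto> \<alpha>)) e"
          using kempe_other[OF c _ False] K(2) by (cases "e = {r, w}") simp_all
      qed
    next
      case xr: False
      from inj show ?thesis
      proof (rule inj_on_agree)
        fix e assume e: "e \<in> {e \<in> edges par. x \<in> e}"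
        then have "e \<noteq> {r, w}" using xr False by auto
        then show "?c e = c e" using kempe_other[OF c _ False] e by simp
      qed
    qed
  qed
  moreover have "dom ?c = edges par" using K(1) by (simp add: separated_def)
  moreover have "ran ?c \<subseteq> {1..\<kappa>}" using K(4) \<alpha> c by (auto simp: proper_def available_def)
  ultimately show ?thesis by (simp add: proper_def)
qed

lemma kempe_free_p:
  assumes "c \<in> colourings"
  shows "free (kempe par r w \<alpha> c) p = free c p"
proof (rule available_cong)
  fix e assume "p \<in> e"
  moreover have "p \<noteq> r" using fresh by auto
  ultimately show "kempe par r w \<alpha> c e = c e"
    using kempe_other[OF assms _ p_notin_desc] p_notin_desc by (cases "e = {r, w}") auto
qed

lemma kempe_free_r:
  assumes c: "c \<in> colourings" and \<alpha>: "\<alpha> \<in> free c r"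
  shows "the (c {r, w}) \<in> free (kempe par r w \<alpha> c) r"
proof -
  obtain \<beta> where \<beta>: "c {r, w} = Some \<beta>" "\<beta> \<in> {1..\<kappa>}" using proper_colour[OF c rw_edge] by blast
  have "kempe par r w \<alpha> c e \<noteq> Some \<beta>" if "r \<in> e" for e
  proof (cases "e = {r, w}")
    case True
    then show ?thesis
      using kempe_properties(2)[OF forest par_w proper_separated[OF c], where \<gamma> = \<alpha>] \<alpha> \<beta> by (auto simp: available_def)
  next
    case False
    then show ?thesis
      using kempe_other[OF c that r_notin_desc False] proper_inj[OF c that _ _ \<beta>(1)] by auto
  qed
  with \<beta> show ?thesis by (auto simp: available_def)
qed

text \<open>Moving \<open>{r, w}\<close> from \<open>\<beta>\<close> to \<open>\<alpha>\<close>
  frees \<open>\<beta>\<close> at \<open>r\<close>. So a colour required only to be free at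
  \<open>p\<close> becomes free at both ends, as a deletion presupposes. \<open>\<Psi>\<close> is
  its own inverse, and therefore serves in both directions.\<close>

lemma kempe_bij:
  defines "\<Psi> \<equiv> \<lambda>(c, \<alpha>). (kempe par r w \<alpha> c, the (c {r, w}))"
  shows "bij_betw \<Psi> (pre_link w) pre_cut" "bij_betw \<Psi> pre_cut (pre_link w)"
proof -
  have "\<Psi> (\<Psi> (c, \<alpha>)) = (c, \<alpha>)" if "c \<in> colourings" for c \<alpha>
    using kempe_properties(2,5)[OF forest par_w proper_separated[OF that]] by (simp add: \<Psi>_def)
  then have inv: "\<Psi> (\<Psi> x) = x" if "x \<in> pre_link w \<union> pre_cut" for x
    using that by (auto simp: pre_link_def pre_cut_def)
  have A: "\<Psi> x \<in> pre_cut" if "x \<in> pre_link w" for x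
    using that kempe_proper kempe_free_p kempe_free_r by (auto simp: pre_link_def pre_cut_def \<Psi>_def)
  have B: "\<Psi> x \<in> pre_link w" if cut: "x \<in> pre_cut" for x
  proof -
    obtain c \<alpha> where x: "x = (c, \<alpha>)" "c \<in> colourings" "\<alpha> \<in> free c p" "\<alpha> \<in> free c r"
      using cut by (auto simp: pre_cut_def)
    then show ?thesis
      using kempe_proper[of c \<alpha>] kempe_free_p[of c \<alpha>] kempe_free_r[of c \<alpha>]
        kempe_properties(2)[OF forest par_w proper_separated[OF x(2)], of \<alpha>]
      by (simp add: pre_link_def \<Psi>_def)
  qed
  show "bij_betw \<Psi> (pre_link w) pre_cut"
    by (rule bij_betw_byWitness[where f' = \<Psi>]) (use A B inv in auto)
  show "bij_betw \<Psi> pre_cut (pre_link w)"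
    by (rule bij_betw_byWitness[where f' = \<Psi>]) (use A B inv in auto)
qed

lemma sum_kempe_link:
  "(\<Sum>(c, \<alpha>)\<in>pre_link w. g (kempe par r w \<alpha> c) (the (c {r, w}))) = (\<Sum>(c, \<beta>)\<in>pre_cut. g c \<beta> :: real)"
  using sum.reindex_bij_betw[OF kempe_bij(1), of "\<lambda>(c, \<beta>). g c \<beta>"] by (simp add: split_def)

lemma sum_kempe_cut:
  "(\<Sum>(c, \<beta>)\<in>pre_cut. g (kempe par r w \<beta> c)) = (\<Sum>(c, \<alpha>)\<in>pre_link w. g c :: real)"
  using sum.reindex_bij_betw[OF kempe_bij(2), of "\<lambda>(c, \<beta>). g c"] by (simp add: split_def)

end

text \<open>A colour used at the root \<open>r\<close> is the colour of exactly one child edge, so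
  the conflicts can be indexed by the children. The same split computes an insertion and reassembles
  the branches of a deletion.\<close>

lemma sum_free_p:
  assumes c: "c \<in> colourings"
  shows "(\<Sum>\<beta>\<in>free c p. g \<beta> :: real) =
    (\<Sum>\<beta>\<in>free c p \<inter> free c r. g \<beta>) + (\<Sum>w\<in>kids. of_bool (the (c {r, w}) \<in> free c p) * g (the (c {r, w})))"
proof -
  let ?W = "{w \<in> kids. the (c {r, w}) \<in> free c p}"
  have ex: "\<exists>\<gamma>. c {r, w} = Some \<gamma>" if "w \<in> kids" for w
    using proper_colour[OF c rw_edge[OF that]] by blast
  have "bij_betw (\<lambda>w. the (c {r, w})) ?W (free c p - free c r)"
    unfolding bij_betw_def
  proof
    show "inj_on (\<lambda>w. the (c {r, w})) ?W"
    proof (rule inj_onI)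
      fix w x assume "w \<in> ?W" "x \<in> ?W" "the (c {r, w}) = the (c {r, x})"
      then have "{r, w} = {r, x}" using ex[of w] ex[of x] proper_inj[OF c, of r "{r, w}" "{r, x}"] by auto
      then show "w = x" by (auto simp: doubleton_eq_iff)
    qed
    have "\<beta> \<in> (\<lambda>w. the (c {r, w})) ` ?W" if \<beta>: "\<beta> \<in> free c p" "\<beta> \<notin> free c r" for \<beta>
    proof -
      obtain e where e: "r \<in> e" "c e = Some \<beta>" using \<beta> by (auto simp: available_def)
      then have "e \<in> edges par" using c by (auto simp: proper_def)
      then obtain v w where "par w = Some v" "e = {v, w}" by (rule edgeE)
      with e(1) root have "w \<in> kids" "e = {r, w}" by (auto simp: children_def)
      with e \<beta> show ?thesis by force
    qed
    moreover have "the (c {r, w}) \<notin> free c r" if "w \<in> kids" for w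
      using ex[OF that] by (auto simp: available_def)
    ultimately show "(\<lambda>w. the (c {r, w})) ` ?W = free c p - free c r" by auto
  qed
  from sum.reindex_bij_betw[OF this, of g]
  have "(\<Sum>\<beta>\<in>free c p - free c r. g \<beta>) = (\<Sum>w\<in>?W. g (the (c {r, w})))" by simp
  also have "\<dots> = (\<Sum>w\<in>kids. of_bool (the (c {r, w}) \<in> free c p) * g (the (c {r, w})))"
    by (intro sum.mono_neutral_cong_left) auto
  finally show ?thesis
    using sum.Int_Diff[of "free c p" g "free c r"] by simp
qed

end

section \<open>Expectations over the random choices of one update\<close>

lemma expectation_bind_pmf_of_set:
  fixes h :: "'b \<Rightarrow> real"
  assumes "A \<noteq> {}" "finite A" "\<And>x. x \<in> A \<Longrightarrow> finite (set_pmf (f x))"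
  shows "measure_pmf.expectation (pmf_of_set A \<bind> f) h =
    (\<Sum>x\<in>A. measure_pmf.expectation (f x) h) / real (card A)"
  using pmf_expectation_bind_pmf_of_set[where h = h, OF assms]
  by (simp only: real_scaleR_def sum_distrib_left[symmetric] divide_inverse mult.commute)

context edge_update
begin

abbreviation "par' \<equiv> par(r \<mapsto> p)"

lemma p_neq_r: "p \<noteq> r"
  using fresh by auto

lemma linked_child_iff: "par' w = Some r \<longleftrightarrow> par w = Some r"
  using root p_neq_r by auto

lemma p_not_child: "par p \<noteq> Some r"
  using fresh ancestor_parent[of par p r] by auto

lemma child_edge_neq: "par w = Some r \<Longrightarrow> {r, w} \<noteq> {p, r}"
  using p_not_child p_neq_r by (auto simp: doubleton_eq_iff)

lemma insert_expectation:
  fixes H :: "'v state \<Rightarrow> real"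
  assumes c: "c \<in> colourings"
  shows "measure_pmf.expectation (rooted_insert \<kappa> p r (par, c)) H =
      ((\<Sum>\<beta>\<in>free c p \<inter> free c r. H (par', c({p, r} \<mapsto> \<beta>))) +
       (\<Sum>w\<in>kids. of_bool (the (c {r, w}) \<in> free c p) *
          ((\<Sum>\<alpha>\<in>free c r. H (par', (kempe par r w \<alpha> c)({p, r} \<mapsto> the (c {r, w})))) / dr))) / dp" (is ?exp)
    and "finite (set_pmf (rooted_insert \<kappa> p r (par, c)))" (is ?fin)
proof -
  define K where "K = (\<lambda>\<beta>. let col' = c({p, r} \<mapsto> \<beta>) in
       if \<exists>w. coloured_child par' col' r \<beta> w
       then do {
         let w = (THE w. coloured_child par' col' r \<beta> w);
         \<alpha> \<leftarrow> pmf_of_set (available \<kappa> col' r);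
         return_pmf (par', fix_forbidden par' w \<beta> \<alpha> (col'({r, w} \<mapsto> \<alpha>)))
       }
       else return_pmf (par', col'))"
  have ins: "rooted_insert \<kappa> p r (par, c) = pmf_of_set (free c p) \<bind> K"
    by (simp add: rooted_insert_def K_def Let_def)
  have ne: "free c p \<noteq> {}" "free c r \<noteq> {}"
    using card_free_p[OF c] dp_pos card_free_r[OF c] dr_pos by force+
  have cc: "coloured_child par' (c({p, r} \<mapsto> \<beta>)) r \<beta> w \<longleftrightarrow> par w = Some r \<and> c {r, w} = Some \<beta>" for \<beta> w
    using child_edge_neq[of w] linked_child_iff[of w]
    by (auto simp: coloured_child_def children_def)
  have K1: "K \<beta> = return_pmf (par', c({p, r} \<mapsto> \<beta>))" if "\<beta> \<in> free c r" for \<beta>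
  proof -
    have no: "(\<exists>w. coloured_child par' (c({p, r} \<mapsto> \<beta>)) r \<beta> w) = False"
      using that unfolding cc by (auto simp: available_def)
    show ?thesis unfolding K_def Let_def no by simp
  qed
  have K2: "K \<beta> = map_pmf (\<lambda>\<alpha>. (par', (kempe par r w \<alpha> c)({p, r} \<mapsto> \<beta>))) (pmf_of_set (free c r))"
    if w: "w \<in> kids" and \<beta>: "c {r, w} = Some \<beta>" for w \<beta>
  proof -
    let ?c = "c({p, r} \<mapsto> \<beta>)"
    note pw = par_w[OF w]
    have uniq: "coloured_child par' ?c r \<beta> = (\<lambda>x. x = w)"
    proof (intro ext iffI)
      fix x assume "coloured_child par' ?c r \<beta> x"
      then have "c {r, x} = Some \<beta>" unfolding cc by blast
      then show "x = w" by (rule separated_child_unique[OF proper_separated[OF c] \<beta>])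
    next
      fix x assume "x = w"
      then show "coloured_child par' ?c r \<beta> x" unfolding cc using pw \<beta> by simp
    qed
    \<comment> \<open>The new edge gets the colour \<open>\<beta>\<close> that \<open>r\<close>
      already sees on \<open>{r, w}\<close>, so the free colours at \<open>r\<close> are the same
      before and after the insertion.\<close>
    have "{\<gamma>. \<exists>e. r \<in> e \<and> ?c e = Some \<gamma>} = {\<gamma>. \<exists>e. r \<in> e \<and> c e = Some \<gamma>}"
    proof (intro equalityI subsetI)
      fix \<gamma> assume "\<gamma> \<in> {\<gamma>. \<exists>e. r \<in> e \<and> ?c e = Some \<gamma>}"
      then obtain e where e: "r \<in> e" "?c e = Some \<gamma>" by blast
      show "\<gamma> \<in> {\<gamma>. \<exists>e. r \<in> e \<and> c e = Some \<gamma>}"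
      proof (cases "e = {p, r}")
        case True
        then have "r \<in> {r, w}" "c {r, w} = Some \<gamma>" using e \<beta> by simp_all
        then show ?thesis by blast
      next
        case False
        then show ?thesis using e by auto
      qed
    next
      fix \<gamma> assume "\<gamma> \<in> {\<gamma>. \<exists>e. r \<in> e \<and> c e = Some \<gamma>}"
      then obtain e where e: "r \<in> e" "c e = Some \<gamma>" by blast
      have "c {p, r} = None" using c pr_notin by (auto simp: proper_def)
      with e(2) have "?c e = Some \<gamma>" by (cases "e = {p, r}") simp_all
      with e(1) show "\<gamma> \<in> {\<gamma>. \<exists>e. r \<in> e \<and> ?c e = Some \<gamma>}" by blast
    qed
    then have av: "available \<kappa> ?c r = free c r" by (simp add: available_def)
    have crw: "?c {r, w} = Some \<beta>" using \<beta> child_edge_neq[OF pw] by simp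
    have "fix_forbidden par' w \<beta> \<alpha> (?c({r, w} \<mapsto> \<alpha>)) = (kempe par r w \<alpha> c)({p, r} \<mapsto> \<beta>)" for \<alpha>
      using kempe_link[OF forest root fresh pw proper_separated[OF c] p_notin_desc[OF w], of \<alpha> "Some \<beta>"]
      by (simp only: kempe_def crw option.sel)
    then show ?thesis
      unfolding K_def Let_def uniq av by (simp add: map_pmf_def)
  qed
  have kids: "\<exists>w\<in>kids. c {r, w} = Some \<beta>" if h: "\<beta> \<in> free c p" "\<beta> \<notin> free c r" for \<beta>
  proof -
    obtain e where e: "r \<in> e" "c e = Some \<beta>" using h by (auto simp: available_def)
    then have "e \<in> edges par" using c by (auto simp: proper_def)
    then obtain v w where vw: "par w = Some v" "e = {v, w}" by (rule edgeE)
    with e(1) root have "r = v" by auto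
    with vw e show ?thesis by (auto simp: children_def)
  qed
  have fin: "finite (set_pmf (K \<beta>))" if "\<beta> \<in> free c p" for \<beta>
  proof (cases "\<beta> \<in> free c r")
    case False
    with that kids obtain w where "w \<in> kids" "c {r, w} = Some \<beta>" by blast
    from K2[OF this] ne show ?thesis by simp
  qed (simp add: K1)
  show ?fin unfolding ins using fin ne by simp
  have "measure_pmf.expectation (rooted_insert \<kappa> p r (par, c)) H =
      (\<Sum>\<beta>\<in>free c p. measure_pmf.expectation (K \<beta>) H) / dp"
    unfolding ins using ne fin
    by (simp add: expectation_bind_pmf_of_set card_free_p[OF c])
  also have "(\<Sum>\<beta>\<in>free c p. measure_pmf.expectation (K \<beta>) H) =
      (\<Sum>\<beta>\<in>free c p \<inter> free c r. H (par', c({p, r} \<mapsto> \<beta>))) +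
      (\<Sum>w\<in>kids. of_bool (the (c {r, w}) \<in> free c p) *
          ((\<Sum>\<alpha>\<in>free c r. H (par', (kempe par r w \<alpha> c)({p, r} \<mapsto> the (c {r, w})))) / dr))"
    unfolding sum_free_p[OF c]
  proof (intro arg_cong2[where f = "(+)"] sum.cong refl)
    fix \<beta> assume "\<beta> \<in> free c p \<inter> free c r"
    then show "measure_pmf.expectation (K \<beta>) H = H (par', c({p, r} \<mapsto> \<beta>))"
      using K1[of \<beta>] by simp
  next
    fix w assume w: "w \<in> kids"
    obtain \<beta> where \<beta>: "c {r, w} = Some \<beta>" using proper_colour[OF c rw_edge[OF w]] by blast
    have "measure_pmf.expectation (K \<beta>) H =
        (\<Sum>\<alpha>\<in>free c r. H (par', (kempe par r w \<alpha> c)({p, r} \<mapsto> \<beta>))) / dr"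
      unfolding K2[OF w \<beta>] using ne
      by (simp add: integral_pmf_of_set card_free_r[OF c] del: fun_upd_apply)
    then show "of_bool (the (c {r, w}) \<in> free c p) * measure_pmf.expectation (K (the (c {r, w}))) H =
      of_bool (the (c {r, w}) \<in> free c p) *
        ((\<Sum>\<alpha>\<in>free c r. H (par', (kempe par r w \<alpha> c)({p, r} \<mapsto> the (c {r, w})))) / dr)"
      by (simp only: \<beta> option.sel)
  qed
  finally show ?exp .
qed

text \<open>The probability \<open>l / \<kappa>\<close> of not stopping cancels against the uniform
  choice among the \<open>l\<close> children: each child is taken with probability
  \<open>1 / \<kappa>\<close>.\<close>

lemma delete_expectation:
  fixes H :: "'v state \<Rightarrow> real"
  assumes c: "c \<in> colourings" and \<alpha>: "\<alpha> \<in> free c p \<inter> free c r"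
  shows "measure_pmf.expectation (rooted_delete \<kappa> p r (par', c({p, r} \<mapsto> \<alpha>))) H =
      dr / real \<kappa> * H (par, c) + (\<Sum>w\<in>kids. H (par, kempe par r w \<alpha> c)) / real \<kappa>" (is ?exp)
    and "finite (set_pmf (rooted_delete \<kappa> p r (par', c({p, r} \<mapsto> \<alpha>))))" (is ?fin)
proof -
  have k: "real \<kappa> > 0" using deg_p by simp
  have "c {p, r} = None" using c pr_notin by (auto simp: proper_def)
  then have c1: "(c({p, r} \<mapsto> \<alpha>))({p, r} := None) = c" by auto
  have p1: "par'(r := None) = par" using root by auto
  define K where "K = (\<lambda>stop. if stop then return_pmf (par, c) else
      map_pmf (\<lambda>w. (par, kempe par r w \<alpha> c)) (pmf_of_set kids))"
  have del: "rooted_delete \<kappa> p r (par', c({p, r} \<mapsto> \<alpha>)) = bernoulli_pmf (dr / real \<kappa>) \<bind> K"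
    unfolding rooted_delete_def prod.case c1 p1 Let_def K_def
    by (simp add: map_pmf_def kempe_def cong: if_cong)
  have "?exp \<and> ?fin"
  proof (cases "kids = {}")
    \<comment> \<open>Without children the uniform choice of a child is meaningless, but stopping
      then has probability 1.\<close>
    case True
    then have "dr / real \<kappa> = 1" using k by simp
    moreover have "bernoulli_pmf 1 = return_pmf True"
      by (rule pmf_eqI) (auto simp: indicator_def)
    ultimately show ?thesis unfolding del using True by (simp add: K_def bind_return_pmf)
  next
    case False
    have fin: "finite (set_pmf (K b))" for b using False by (simp add: K_def)
    have dr: "0 \<le> dr / real \<kappa>" "dr / real \<kappa> \<le> 1" using dr_pos k by (auto simp: field_simps)
    have "measure_pmf.expectation (bernoulli_pmf (dr / real \<kappa>) \<bind> K) H =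
        dr / real \<kappa> * measure_pmf.expectation (K True) H + (1 - dr / real \<kappa>) * measure_pmf.expectation (K False) H"
      using fin dr by (subst pmf_expectation_bind[of UNIV]) (auto simp: UNIV_bool)
    also have "measure_pmf.expectation (K False) H = (\<Sum>w\<in>kids. H (par, kempe par r w \<alpha> c)) / real (card kids)"
      using False by (simp add: K_def integral_pmf_of_set)
    also have "1 - dr / real \<kappa> = real (card kids) / real \<kappa>" using k by (simp add: field_simps)
    finally have ?exp unfolding del using False by (simp add: K_def)
    moreover have ?fin unfolding del using fin by simp
    ultimately show ?thesis by blast
  qed
  then show ?exp ?fin by blast+
qed

text \<open>\<open>G\<close> may depend on the colouring before the update. With a function of the
  new state it yields uniformity, with the recourse it yields the bound.\<close>

lemma insert_total:
  fixes G :: "'v colouring \<Rightarrow> 'v state \<Rightarrow> real"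
  shows "(\<Sum>c\<in>colourings. measure_pmf.expectation (rooted_insert \<kappa> p r (par, c)) (G c)) =
    ((\<Sum>(c, \<beta>)\<in>pre_cut. G c (par', c({p, r} \<mapsto> \<beta>))) +
     (\<Sum>w\<in>kids. \<Sum>(c, \<alpha>)\<in>pre_link w. G c (par', (kempe par r w \<alpha> c)({p, r} \<mapsto> the (c {r, w})))) / dr) / dp"
proof -
  let ?g = "\<lambda>w c \<alpha>. G c (par', (kempe par r w \<alpha> c)({p, r} \<mapsto> the (c {r, w})))"
  have "(\<Sum>c\<in>colourings. measure_pmf.expectation (rooted_insert \<kappa> p r (par, c)) (G c)) =
     (\<Sum>c\<in>colourings. ((\<Sum>\<beta>\<in>free c p \<inter> free c r. G c (par', c({p, r} \<mapsto> \<beta>))) +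
       (\<Sum>w\<in>kids. of_bool (the (c {r, w}) \<in> free c p) * ((\<Sum>\<alpha>\<in>free c r. ?g w c \<alpha>) / dr))) / dp)"
    by (intro sum.cong refl insert_expectation(1))
  also have "\<dots> = ((\<Sum>c\<in>colourings. \<Sum>\<beta>\<in>free c p \<inter> free c r. G c (par', c({p, r} \<mapsto> \<beta>))) +
       (\<Sum>c\<in>colourings. \<Sum>w\<in>kids. of_bool (the (c {r, w}) \<in> free c p) * (\<Sum>\<alpha>\<in>free c r. ?g w c \<alpha>)) / dr) / dp"
    by (simp only: sum_divide_distrib[symmetric] sum.distrib times_divide_eq_right)
  also have "(\<Sum>c\<in>colourings. \<Sum>w\<in>kids. of_bool (the (c {r, w}) \<in> free c p) * (\<Sum>\<alpha>\<in>free c r. ?g w c \<alpha>)) =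
      (\<Sum>w\<in>kids. \<Sum>(c, \<alpha>)\<in>pre_link w. ?g w c \<alpha>)"
    unfolding sum_pre_link by (rule sum.swap)
  finally show ?thesis by (simp only: sum_pre_cut)
qed

lemma delete_total:
  fixes G :: "'v colouring \<Rightarrow> 'v state \<Rightarrow> real"
  shows "(\<Sum>c\<in>linked. measure_pmf.expectation (rooted_delete \<kappa> p r (par', c)) (G c)) =
    (dr * (\<Sum>(c, \<alpha>)\<in>pre_cut. G (c({p, r} \<mapsto> \<alpha>)) (par, c)) +
     (\<Sum>w\<in>kids. \<Sum>(c, \<alpha>)\<in>pre_cut. G (c({p, r} \<mapsto> \<alpha>)) (par, kempe par r w \<alpha> c))) / real \<kappa>"
proof -
  have "(\<Sum>c\<in>linked. measure_pmf.expectation (rooted_delete \<kappa> p r (par', c)) (G c)) =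
    (\<Sum>(c, \<alpha>)\<in>pre_cut. dr / real \<kappa> * G (c({p, r} \<mapsto> \<alpha>)) (par, c) +
      (\<Sum>w\<in>kids. G (c({p, r} \<mapsto> \<alpha>)) (par, kempe par r w \<alpha> c)) / real \<kappa>)"
    unfolding sum_linked
    by (intro sum.cong refl) (auto simp: pre_cut_def delete_expectation(1) simp del: fun_upd_apply)
  also have "\<dots> = (\<Sum>x\<in>pre_cut. dr / real \<kappa> * G ((fst x)({p, r} \<mapsto> snd x)) (par, fst x)) +
      (\<Sum>x\<in>pre_cut. \<Sum>w\<in>kids. G ((fst x)({p, r} \<mapsto> snd x)) (par, kempe par r w (snd x) (fst x)) / real \<kappa>)"
    by (simp only: split_def sum.distrib sum_divide_distrib)
  also have "(\<Sum>x\<in>pre_cut. \<Sum>w\<in>kids. G ((fst x)({p, r} \<mapsto> snd x)) (par, kempe par r w (snd x) (fst x)) / real \<kappa>) =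
      (\<Sum>w\<in>kids. \<Sum>x\<in>pre_cut. G ((fst x)({p, r} \<mapsto> snd x)) (par, kempe par r w (snd x) (fst x)) / real \<kappa>)"
    by (rule sum.swap)
  finally show ?thesis
    by (simp only: split_def sum_divide_distrib sum_distrib_left add_divide_distrib times_divide_eq_left)
qed

lemma insert_total_uniform:
  fixes H :: "'v state \<Rightarrow> real"
  shows "(\<Sum>c\<in>colourings. measure_pmf.expectation (rooted_insert \<kappa> p r (par, c)) H) =
    (\<Sum>c\<in>linked. H (par', c)) * real \<kappa> / (dr * dp)"
proof -
  let ?S = "\<Sum>c\<in>linked. H (par', c)"
  have "(\<Sum>(c, \<alpha>)\<in>pre_link w. H (par', (kempe par r w \<alpha> c)({p, r} \<mapsto> the (c {r, w})))) = ?S"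
    if "w \<in> kids" for w
    using sum_kempe_link[OF that, of "\<lambda>c \<beta>. H (par', c({p, r} \<mapsto> \<beta>))"] by (simp only: sum_linked)
  then have "(\<Sum>c\<in>colourings. measure_pmf.expectation (rooted_insert \<kappa> p r (par, c)) H) =
      (?S + real (card kids) * ?S / dr) / dp"
    unfolding insert_total by (simp add: sum_linked del: fun_upd_apply)
  \<comment> \<open>Since \<open>dr + card kids = \<kappa>\<close>, the factor
    \<open>1 + card kids / dr\<close> equals \<open>\<kappa> / dr\<close>.\<close>
  also have "\<dots> = ?S * real \<kappa> / (dr * dp)"
    using dr_pos dp_pos by (simp add: field_simps)
  finally show ?thesis .
qed

text \<open>The weights in the previous lemma are normalised by \<open>H = 1\<close>, so the colourings need not be counted.\<close>

lemma card_linked: "real (card linked) * real \<kappa> = real (card colourings) * dr * dp"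
proof -
  have "real (card colourings) = real (card linked) * real \<kappa> / (dr * dp)"
    using insert_total_uniform[of "\<lambda>_. 1"] by simp
  moreover have "dr * dp \<noteq> 0" using dr_pos dp_pos by simp
  ultimately show ?thesis by (simp only: eq_divide_eq mult.assoc not_False_eq_True if_True)
qed

lemma delete_total_uniform:
  fixes H :: "'v state \<Rightarrow> real"
  shows "(\<Sum>c\<in>linked. measure_pmf.expectation (rooted_delete \<kappa> p r (par', c)) H) =
    (\<Sum>c\<in>colourings. H (par, c)) * dr * dp / real \<kappa>"
proof -
  \<comment> \<open>Summing over \<open>pre_link w\<close> instead, the second component ranges over
    all colours free at \<open>r\<close> and contributes the factor \<open>dr\<close>, which is also
    the weight of the stopping branch.\<close>
  have "(\<Sum>(c, \<alpha>)\<in>pre_cut. H (par, kempe par r w \<alpha> c)) =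
      dr * (\<Sum>c\<in>colourings. of_bool (the (c {r, w}) \<in> free c p) * H (par, c))" if "w \<in> kids" for w
  proof -
    have "(\<Sum>(c, \<alpha>)\<in>pre_cut. H (par, kempe par r w \<alpha> c)) = (\<Sum>(c, \<alpha>)\<in>pre_link w. H (par, c))"
      by (rule sum_kempe_cut[OF that])
    also have "\<dots> = (\<Sum>c\<in>colourings. of_bool (the (c {r, w}) \<in> free c p) * (dr * H (par, c)))"
      unfolding sum_pre_link by (intro sum.cong refl) (simp add: card_free_r)
    finally show ?thesis by (simp only: sum_distrib_left mult.left_commute)
  qed
  then have "(\<Sum>c\<in>linked. measure_pmf.expectation (rooted_delete \<kappa> p r (par', c)) H) =
      (dr * (\<Sum>(c, \<alpha>)\<in>pre_cut. H (par, c)) +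
       (\<Sum>w\<in>kids. dr * (\<Sum>c\<in>colourings. of_bool (the (c {r, w}) \<in> free c p) * H (par, c)))) / real \<kappa>"
    unfolding delete_total by simp
  also have "\<dots> = dr * ((\<Sum>(c, \<alpha>)\<in>pre_cut. H (par, c)) +
       (\<Sum>w\<in>kids. \<Sum>c\<in>colourings. of_bool (the (c {r, w}) \<in> free c p) * H (par, c))) / real \<kappa>"
    by (simp only: sum_distrib_left distrib_left)
  also have "(\<Sum>w\<in>kids. \<Sum>c\<in>colourings. of_bool (the (c {r, w}) \<in> free c p) * H (par, c)) =
     (\<Sum>c\<in>colourings. \<Sum>w\<in>kids. of_bool (the (c {r, w}) \<in> free c p) * H (par, c))"
    by (rule sum.swap)
  \<comment> \<open>The two kinds of branches together run through all colours free at
    \<open>p\<close>, and their number \<open>dp\<close> does not depend on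
    \<open>c\<close>.\<close>
  also have "(\<Sum>(c, \<alpha>)\<in>pre_cut. H (par, c)) + \<dots> = (\<Sum>c\<in>colourings. \<Sum>\<beta>\<in>free c p. H (par, c))"
    unfolding sum_pre_cut sum.distrib[symmetric]
    by (intro sum.cong refl) (simp only: sum_free_p)
  also have "\<dots> = (\<Sum>c\<in>colourings. H (par, c)) * dp"
    unfolding sum_distrib_right by (intro sum.cong refl) (simp add: card_free_p mult.commute)
  finally show ?thesis by (simp only: mult_ac)
qed

end

section \<open>Total recourse of an update over all colourings\<close>

definition supersolution :: "'v parents \<Rightarrow> nat \<Rightarrow> real \<Rightarrow> ('v \<Rightarrow> real) \<Rightarrow> bool" where
  "supersolution par \<kappa> B R \<longleftrightarrow>
     (\<forall>w. par w \<noteq> None \<longrightarrow> 1 + (\<Sum>x\<in>children par w. R x) / real (\<kappa> - 1) \<le> R w \<and> R w \<le> B)"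

context edge_update
begin

text \<open>\<open>Q\<close> selects the pairs that start a chain; \<open>pre_link w\<close> and
  \<open>pre_cut\<close> are both of this form. As \<open>Q\<close> is determined outside the
  subtree of \<open>w\<close>, its indicator is an admissible weight once both colours of the chain
  are fixed.\<close>

lemma chain_length_sum:
  assumes w: "w \<in> kids" and R: "supersolution par \<kappa> B R"
    and inv: "\<And>\<alpha> c c'. (\<And>e. \<not> e \<subseteq> desc par w \<Longrightarrow> c e = c' e) \<Longrightarrow> Q c \<alpha> \<longleftrightarrow> Q c' \<alpha>"
    and Q: "\<And>c \<alpha>. c \<in> colourings \<Longrightarrow> Q c \<alpha> \<Longrightarrow> \<alpha> \<in> {1..\<kappa>} \<and> \<alpha> \<noteq> the (c {r, w})"
  defines "Z \<equiv> {(c, \<alpha>). c \<in> colourings \<and> Q c \<alpha>}"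
  shows "(\<Sum>(c, \<alpha>)\<in>Z. real (chain_length par r w \<alpha> c)) \<le> B * real (card Z)"
proof -
  note pw = par_w[OF w]
  \<comment> \<open>The sum is split by the new colour \<open>\<alpha>\<close> and the old colour
    \<open>\<beta>\<close> of \<open>{r, w}\<close>; \<open>Q\<close> makes the terms with
    \<open>\<alpha> = \<beta>\<close> vanish.\<close>
  define f :: "nat \<Rightarrow> nat \<Rightarrow> 'v colouring \<Rightarrow> real" where "f = (\<lambda>\<alpha> \<beta> c. of_bool (Q c \<alpha> \<and> c {r, w} = Some \<beta>))"
  have ex: "(\<Sum>(c, \<alpha>)\<in>Z. g c \<alpha>) = (\<Sum>\<alpha>\<in>{1..\<kappa>}. \<Sum>\<beta>\<in>{1..\<kappa>}. \<Sum>c\<in>colourings. f \<alpha> \<beta> c * g c \<alpha>)"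
    for g :: "'v colouring \<Rightarrow> nat \<Rightarrow> real"
  proof -
    have one: "(\<Sum>\<beta>\<in>{1..\<kappa>}. f \<alpha> \<beta> c) = of_bool (Q c \<alpha>)" if c: "c \<in> colourings" for c \<alpha>
    proof -
      obtain \<gamma> where \<gamma>: "c {r, w} = Some \<gamma>" "\<gamma> \<in> {1..\<kappa>}" using proper_colour[OF c rw_edge[OF w]] by blast
      have "(\<Sum>\<beta>\<in>{1..\<kappa>}. f \<alpha> \<beta> c) = (\<Sum>\<beta>\<in>{\<gamma>}. of_bool (Q c \<alpha>))"
        using \<gamma> by (intro sum.mono_neutral_cong_right) (auto simp: f_def)
      then show ?thesis by simp
    qed
    have "(\<Sum>(c, \<alpha>)\<in>Z. g c \<alpha>) = (\<Sum>(c, \<alpha>)\<in>colourings \<times> {1..\<kappa>}. of_bool (Q c \<alpha>) * g c \<alpha>)"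
      using Q by (intro sum.mono_neutral_cong_left) (auto simp: Z_def)
    also have "\<dots> = (\<Sum>c\<in>colourings. \<Sum>\<alpha>\<in>{1..\<kappa>}. of_bool (Q c \<alpha>) * g c \<alpha>)"
      by (rule sum.cartesian_product[symmetric])
    also have "\<dots> = (\<Sum>\<alpha>\<in>{1..\<kappa>}. \<Sum>c\<in>colourings. of_bool (Q c \<alpha>) * g c \<alpha>)"
      by (rule sum.swap)
    also have "\<dots> = (\<Sum>\<alpha>\<in>{1..\<kappa>}. \<Sum>c\<in>colourings. \<Sum>\<beta>\<in>{1..\<kappa>}. f \<alpha> \<beta> c * g c \<alpha>)"
      by (intro sum.cong refl) (simp only: one sum_distrib_right[symmetric])
    also have "\<dots> = (\<Sum>\<alpha>\<in>{1..\<kappa>}. \<Sum>\<beta>\<in>{1..\<kappa>}. \<Sum>c\<in>colourings. f \<alpha> \<beta> c * g c \<alpha>)"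
      by (intro sum.cong refl sum.swap)
    finally show ?thesis .
  qed
  have "(\<Sum>c\<in>colourings. f \<alpha> \<beta> c * real (chain_length par r w \<alpha> c)) \<le> R w * (\<Sum>c\<in>colourings. f \<alpha> \<beta> c)"
    if "\<alpha> \<in> {1..\<kappa>}" "\<beta> \<in> {1..\<kappa>}" for \<alpha> \<beta>
  proof (cases "\<alpha> = \<beta>")
    case True
    then have "f \<alpha> \<beta> c = 0" if "c \<in> colourings" for c using Q[OF that, of \<alpha>] by (auto simp: f_def)
    then show ?thesis by simp
  next
    case False
    have "invariant_below par w (f \<alpha> \<beta>)"
      unfolding invariant_below_def
    proof (intro allI impI)
      fix c c' :: "'v colouring" assume eq: "\<forall>e. \<not> e \<subseteq> desc par w \<longrightarrow> c e = c' e"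
      then have "c {r, w} = c' {r, w}" using r_notin_desc[OF w] by auto
      moreover have "Q c \<alpha> \<longleftrightarrow> Q c' \<alpha>" using eq by (intro inv) blast
      ultimately show "f \<alpha> \<beta> c = f \<alpha> \<beta> c'" by (simp add: f_def)
    qed
    moreover have "1 + (\<Sum>x\<in>children par w. R x) / real (\<kappa> - 1) \<le> R w" if "par w \<noteq> None" for w
      using R that by (simp add: supersolution_def)
    ultimately show ?thesis
      using that False by (intro expected_chain_length[OF forest _ pw, where \<beta> = \<beta>]) (auto simp: f_def)
  qed
  then have "(\<Sum>(c, \<alpha>)\<in>Z. real (chain_length par r w \<alpha> c)) \<le>
      (\<Sum>\<alpha>\<in>{1..\<kappa>}. \<Sum>\<beta>\<in>{1..\<kappa>}. R w * (\<Sum>c\<in>colourings. f \<alpha> \<beta> c))"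
    unfolding ex by (intro sum_mono) blast
  also have "\<dots> = R w * (\<Sum>(c, \<alpha>)\<in>Z. 1)"
    unfolding ex by (simp add: sum_distrib_left)
  also have "\<dots> \<le> B * real (card Z)"
    using R pw by (auto simp: supersolution_def intro!: mult_right_mono)
  finally show ?thesis .
qed

lemma available_invariant:
  assumes "\<And>e. \<not> e \<subseteq> desc par w \<Longrightarrow> c e = c' e" "x \<notin> desc par w"
  shows "free c x = free c' x"
  using assms by (intro available_cong) blast

lemma chain_length_pre_link:
  assumes w: "w \<in> kids" and R: "supersolution par \<kappa> B R"
  shows "(\<Sum>(c, \<alpha>)\<in>pre_link w. real (chain_length par r w \<alpha> c)) \<le> B * real (card (pre_link w))"
  unfolding pre_link_def
proof (rule chain_length_sum[OF w R])
  fix \<alpha> and c c' :: "'v colouring" assume eq: "\<And>e. \<not> e \<subseteq> desc par w \<Longrightarrow> c e = c' e"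
  have "c {r, w} = c' {r, w}" using eq r_notin_desc[OF w] by auto
  then show "the (c {r, w}) \<in> free c p \<and> \<alpha> \<in> free c r \<longleftrightarrow> the (c' {r, w}) \<in> free c' p \<and> \<alpha> \<in> free c' r"
    using available_invariant[OF eq p_notin_desc[OF w]] available_invariant[OF eq r_notin_desc[OF w]] by simp
next
  fix c \<alpha> assume c: "c \<in> colourings" and "the (c {r, w}) \<in> free c p \<and> \<alpha> \<in> free c r"
  then have \<alpha>: "\<alpha> \<in> free c r" by simp
  obtain \<gamma> where "c {r, w} = Some \<gamma>" using proper_colour[OF c rw_edge[OF w]] by blast
  with \<alpha> show "\<alpha> \<in> {1..\<kappa>} \<and> \<alpha> \<noteq> the (c {r, w})" by (auto simp: available_def)
qed

lemma chain_length_pre_cut: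
  assumes w: "w \<in> kids" and R: "supersolution par \<kappa> B R"
  shows "(\<Sum>(c, \<alpha>)\<in>pre_cut. real (chain_length par r w \<alpha> c)) \<le> B * real (card pre_cut)"
  unfolding pre_cut_def
proof (rule chain_length_sum[OF w R])
  fix \<alpha> and c c' :: "'v colouring" assume eq: "\<And>e. \<not> e \<subseteq> desc par w \<Longrightarrow> c e = c' e"
  show "\<alpha> \<in> free c p \<inter> free c r \<longleftrightarrow> \<alpha> \<in> free c' p \<inter> free c' r"
    using available_invariant[OF eq p_notin_desc[OF w]] available_invariant[OF eq r_notin_desc[OF w]] by simp
next
  fix c \<alpha> assume c: "c \<in> colourings" and "\<alpha> \<in> free c p \<inter> free c r"
  then have \<alpha>: "\<alpha> \<in> free c r" by simp
  obtain \<gamma> where "c {r, w} = Some \<gamma>" using proper_colour[OF c rw_edge[OF w]] by blast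
  with \<alpha> show "\<alpha> \<in> {1..\<kappa>} \<and> \<alpha> \<noteq> the (c {r, w})" by (auto simp: available_def)
qed

lemma card_pre_cut: "card pre_cut = card linked"
  using sum_linked[of "\<lambda>_. 1"] by simp

lemma card_pre_link: "w \<in> kids \<Longrightarrow> card (pre_link w) = card linked"
  using kempe_bij(1)[of w] by (simp add: bij_betw_same_card card_pre_cut[symmetric])

text \<open>The edge \<open>{p, r}\<close> is coloured on one side of the update only, so recourse
  can only come from the flip.\<close>

lemma recourse_le_chain_length:
  assumes c: "c \<in> colourings"
  shows "recourse (par, c) (par', (kempe par r w \<alpha> c)({p, r} \<mapsto> z)) \<le> chain_length par r w \<alpha> c"
    and "recourse (par', c({p, r} \<mapsto> z)) (par, kempe par r w \<alpha> c) \<le> chain_length par r w \<alpha> c"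
    and "recourse (par, c) (par', c({p, r} \<mapsto> z)) = 0"
    and "recourse (par', c({p, r} \<mapsto> z)) (par, c) = 0"
proof -
  have c0: "c {p, r} = None" using c pr_notin by (auto simp: proper_def)
  show "recourse (par, c) (par', (kempe par r w \<alpha> c)({p, r} \<mapsto> z)) \<le> chain_length par r w \<alpha> c"
    unfolding recourse_def chain_length_def using c0 by (intro card_mono) auto
  show "recourse (par, c) (par', c({p, r} \<mapsto> z)) = 0"
    unfolding recourse_def using c0 by (auto simp: card_eq_0_iff)
  show "recourse (par', c({p, r} \<mapsto> z)) (par, c) = 0"
    unfolding recourse_def using c0 by (auto simp: card_eq_0_iff split: if_splits)
  show "recourse (par', c({p, r} \<mapsto> z)) (par, kempe par r w \<alpha> c) \<le> chain_length par r w \<alpha> c"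
    unfolding recourse_def chain_length_def using c0 by (intro card_mono) (auto split: if_splits)
qed

text \<open>By \<open>card_linked\<close> the weight \<open>1 / (dr * dp)\<close> of a pair amounts
  to probability \<open>1 / \<kappa>\<close> for a conflict at a given child, the same as in a
  deletion.\<close>

lemma insert_recourse_total:
  assumes R: "supersolution par \<kappa> B R"
  shows "(\<Sum>c\<in>colourings. measure_pmf.expectation (rooted_insert \<kappa> p r (par, c)) (\<lambda>s. real (recourse (par, c) s)))
    \<le> real (card colourings) * (real (card kids) * B / real \<kappa>)" (is "?L \<le> _")
proof -
  have "(\<Sum>(c, \<alpha>)\<in>pre_link w. real (recourse (par, c) (par', (kempe par r w \<alpha> c)({p, r} \<mapsto> the (c {r, w})))))
      \<le> B * real (card linked)" if w: "w \<in> kids" for w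
  proof -
    have "(\<Sum>(c, \<alpha>)\<in>pre_link w. real (recourse (par, c) (par', (kempe par r w \<alpha> c)({p, r} \<mapsto> the (c {r, w})))))
      \<le> (\<Sum>(c, \<alpha>)\<in>pre_link w. real (chain_length par r w \<alpha> c))"
      by (intro sum_mono) (auto simp: pre_link_def recourse_le_chain_length(1) simp del: fun_upd_apply)
    also have "\<dots> \<le> B * real (card linked)"
      using chain_length_pre_link[OF w R] by (simp add: card_pre_link[OF w])
    finally show ?thesis .
  qed
  then have "(\<Sum>w\<in>kids. \<Sum>(c, \<alpha>)\<in>pre_link w. real (recourse (par, c) (par', (kempe par r w \<alpha> c)({p, r} \<mapsto> the (c {r, w})))))
      \<le> real (card kids) * (B * real (card linked))"
    by (rule sum_bounded_above)
  moreover have "(\<Sum>(c, \<beta>)\<in>pre_cut. real (recourse (par, c) (par', c({p, r} \<mapsto> \<beta>)))) = 0"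
    by (intro sum.neutral) (auto simp: pre_cut_def recourse_le_chain_length(3) simp del: fun_upd_apply)
  ultimately have "?L \<le> real (card kids) * (B * real (card linked)) / dr / dp"
    unfolding insert_total using dr_pos dp_pos by (simp add: divide_right_mono del: fun_upd_apply)
  also have "\<dots> = real (card kids) * B * (real (card linked) / (dr * dp))" by simp
  also have "real (card linked) / (dr * dp) = real (card colourings) / real \<kappa>"
    using card_linked dr_pos dp_pos deg_p by (subst frac_eq_eq) (simp_all only: mult_ac, auto)
  finally show ?thesis by (simp add: mult_ac)
qed

lemma delete_recourse_total:
  assumes R: "supersolution par \<kappa> B R"
  shows "(\<Sum>c\<in>linked. measure_pmf.expectation (rooted_delete \<kappa> p r (par', c)) (\<lambda>s. real (recourse (par', c) s)))
    \<le> real (card linked) * (real (card kids) * B / real \<kappa>)" (is "?L \<le> _")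
proof -
  have "(\<Sum>(c, \<alpha>)\<in>pre_cut. real (recourse (par', c({p, r} \<mapsto> \<alpha>)) (par, kempe par r w \<alpha> c)))
      \<le> B * real (card linked)" if w: "w \<in> kids" for w
  proof -
    have "(\<Sum>(c, \<alpha>)\<in>pre_cut. real (recourse (par', c({p, r} \<mapsto> \<alpha>)) (par, kempe par r w \<alpha> c)))
      \<le> (\<Sum>(c, \<alpha>)\<in>pre_cut. real (chain_length par r w \<alpha> c))"
      by (intro sum_mono) (auto simp: pre_cut_def recourse_le_chain_length(2) simp del: fun_upd_apply)
    also have "\<dots> \<le> B * real (card linked)"
      using chain_length_pre_cut[OF w R] by (simp add: card_pre_cut)
    finally show ?thesis .
  qed
  then have "(\<Sum>w\<in>kids. \<Sum>(c, \<alpha>)\<in>pre_cut. real (recourse (par', c({p, r} \<mapsto> \<alpha>)) (par, kempe par r w \<alpha> c)))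
      \<le> real (card kids) * (B * real (card linked))"
    by (rule sum_bounded_above)
  moreover have "(\<Sum>(c, \<alpha>)\<in>pre_cut. real (recourse (par', c({p, r} \<mapsto> \<alpha>)) (par, c))) = 0"
    by (intro sum.neutral) (auto simp: pre_cut_def recourse_le_chain_length(4) simp del: fun_upd_apply)
  ultimately have "?L \<le> real (card kids) * (B * real (card linked)) / real \<kappa>"
    unfolding delete_total by (simp add: divide_right_mono del: fun_upd_apply)
  then show ?thesis by (simp add: mult_ac)
qed

end

section \<open>Updates started from the uniform distribution\<close>

definition uniform_state :: "nat \<Rightarrow> 'v parents \<Rightarrow> 'v state pmf" where
  "uniform_state \<kappa> par = map_pmf (Pair par) (pmf_of_set (proper \<kappa> (edges par)))"

definition step_recourse :: "'v state pmf \<Rightarrow> ('v state \<Rightarrow> 'v state pmf) \<Rightarrow> real" where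
  "step_recourse S step =
     measure_pmf.expectation (do { s \<leftarrow> S; s' \<leftarrow> step s; return_pmf (recourse s s') }) real"

lemma uniform_state_step:
  fixes step :: "'v::finite state \<Rightarrow> 'v state pmf"
  assumes "proper \<kappa> (edges par) \<noteq> {}"
    and fin: "\<And>c. c \<in> proper \<kappa> (edges par) \<Longrightarrow> finite (set_pmf (step (par, c)))"
  shows "step_recourse (uniform_state \<kappa> par) step =
      (\<Sum>c\<in>proper \<kappa> (edges par). measure_pmf.expectation (step (par, c)) (\<lambda>s. real (recourse (par, c) s))) /
        real (card (proper \<kappa> (edges par)))"
    and "measure_pmf.expectation (uniform_state \<kappa> par \<bind> step) (H :: 'v state \<Rightarrow> real) =
      (\<Sum>c\<in>proper \<kappa> (edges par). measure_pmf.expectation (step (par, c)) H) /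
        real (card (proper \<kappa> (edges par)))"
proof -
  let ?\<Omega> = "proper \<kappa> (edges par)"
  have "step_recourse (uniform_state \<kappa> par) step =
      measure_pmf.expectation (pmf_of_set ?\<Omega> \<bind> (\<lambda>c. map_pmf (recourse (par, c)) (step (par, c)))) real"
    by (simp add: step_recourse_def uniform_state_def bind_map_pmf map_pmf_def[symmetric])
  then show "step_recourse (uniform_state \<kappa> par) step =
      (\<Sum>c\<in>?\<Omega>. measure_pmf.expectation (step (par, c)) (\<lambda>s. real (recourse (par, c) s))) / real (card ?\<Omega>)"
    using assms finite_proper[of \<kappa> "edges par"]
    by (simp add: expectation_bind_pmf_of_set)
  show "measure_pmf.expectation (uniform_state \<kappa> par \<bind> step) H =
      (\<Sum>c\<in>?\<Omega>. measure_pmf.expectation (step (par, c)) H) / real (card ?\<Omega>)"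
    using assms finite_proper[of \<kappa> "edges par"]
    by (simp add: uniform_state_def bind_map_pmf expectation_bind_pmf_of_set)
qed

text \<open>Indicators of single states determine a distribution, so uniformity follows from the
  totals computed for arbitrary test functions.\<close>

lemma pmf_eq_uniform_state:
  fixes par :: "'v::finite parents"
  assumes "\<And>H :: 'v state \<Rightarrow> real. measure_pmf.expectation M H =
      (\<Sum>c\<in>proper \<kappa> (edges par). H (par, c)) / real (card (proper \<kappa> (edges par)))"
    and "proper \<kappa> (edges par) \<noteq> {}"
  shows "M = uniform_state \<kappa> par"
proof (rule pmf_eqI)
  fix s
  have "pmf M s = measure_pmf.expectation M (indicator {s})"
    by (simp add: measure_pmf_single)
  also have "\<dots> = measure_pmf.expectation (uniform_state \<kappa> par) (indicator {s})"
    unfolding assms(1) uniform_state_def integral_map_pmf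
    by (simp only: integral_pmf_of_set[OF assms(2) finite_proper])
  also have "\<dots> = pmf (uniform_state \<kappa> par) s"
    by (simp add: measure_pmf_single)
  finally show "pmf M s = pmf (uniform_state \<kappa> par) s" .
qed

lemma rescale_ratio:
  fixes x k a b M N :: real
  assumes "M * k = N * a * b" "a > 0" "b > 0" "k > 0" "N > 0"
  shows "(x * k / (a * b)) / N = x / M" "(x * a * b / k) / M = x / N"
proof -
  have M: "M = N * a * b / k" using assms by (simp add: eq_divide_eq)
  show "(x * k / (a * b)) / N = x / M" "(x * a * b / k) / M = x / N"
    unfolding M using assms(2-) by (simp_all add: field_simps)
qed

context edge_update
begin

lemma edges_par': "edges par' = insert {p, r} (edges par)"
  using root by (rule edges_link)

lemma insert_step:
  assumes ne: "colourings \<noteq> {}" and R: "supersolution par \<kappa> B R"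
  shows "linked \<noteq> {}"
    and "uniform_state \<kappa> par \<bind> rooted_insert \<kappa> p r = uniform_state \<kappa> par'"
    and "step_recourse (uniform_state \<kappa> par) (rooted_insert \<kappa> p r) \<le> real (card kids) * B / real \<kappa>"
proof -
  have N: "real (card colourings) > 0" using ne by (simp add: card_gt_0_iff)
  show linked: "linked \<noteq> {}"
  proof
    assume "linked = {}"
    then have "real (card colourings) * dr * dp = 0" using card_linked by simp
    then show False using N dr_pos dp_pos by simp
  qed
  note step = uniform_state_step[where par = par and step = "rooted_insert \<kappa> p r", OF ne insert_expectation(2)]
  have "real \<kappa> > 0" using deg_p by simp
  from rescale_ratio(1)[OF card_linked dr_pos dp_pos this N]
  show "uniform_state \<kappa> par \<bind> rooted_insert \<kappa> p r = uniform_state \<kappa> par'"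
    using linked by (intro pmf_eq_uniform_state) (simp_all only: step(2) insert_total_uniform edges_par' not_False_eq_True)
  show "step_recourse (uniform_state \<kappa> par) (rooted_insert \<kappa> p r) \<le> real (card kids) * B / real \<kappa>"
    using insert_recourse_total[OF R] N by (simp add: step(1) pos_divide_le_eq mult_ac)
qed

lemma delete_step:
  assumes ne: "linked \<noteq> {}" and R: "supersolution par \<kappa> B R"
  shows "colourings \<noteq> {}"
    and "uniform_state \<kappa> par' \<bind> rooted_delete \<kappa> p r = uniform_state \<kappa> par"
    and "step_recourse (uniform_state \<kappa> par') (rooted_delete \<kappa> p r) \<le> real (card kids) * B / real \<kappa>"
proof -
  have N: "real (card linked) > 0" using ne by (simp add: card_gt_0_iff)
  show col: "colourings \<noteq> {}" using ne proper_delete_edge[OF _ pr_notin] by blast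
  have fin: "finite (set_pmf (rooted_delete \<kappa> p r (par', c)))" if c: "c \<in> linked" for c
  proof -
    have "c({p, r} := None) \<in> colourings" "the (c {p, r}) \<in> free (c({p, r} := None)) p \<inter> free (c({p, r} := None)) r"
      using proper_delete_edge[OF c pr_notin] available_delete_edge[OF c] by auto
    moreover have "(c({p, r} := None))({p, r} \<mapsto> the (c {p, r})) = c"
      using proper_colour[OF c, of "{p, r}"] by (metis fun_upd_triv fun_upd_upd insertI1 option.sel)
    ultimately show ?thesis using delete_expectation(2) by metis
  qed
  note step = uniform_state_step[where par = par' and step = "rooted_delete \<kappa> p r", unfolded edges_par', OF ne fin]
  have "real (card colourings) > 0" using col by (simp add: card_gt_0_iff)
  moreover have "real \<kappa> > 0" using deg_p by simp
  ultimately have "(x * dr * dp / real \<kappa>) / real (card linked) = x / real (card colourings)" for x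
    by (intro rescale_ratio(2)[OF card_linked dr_pos dp_pos])
  then show "uniform_state \<kappa> par' \<bind> rooted_delete \<kappa> p r = uniform_state \<kappa> par"
    using col by (intro pmf_eq_uniform_state) (simp_all only: step(2) delete_total_uniform not_False_eq_True)
  show "step_recourse (uniform_state \<kappa> par') (rooted_delete \<kappa> p r) \<le> real (card kids) * B / real \<kappa>"
    using delete_recourse_total[OF R] N by (simp add: step(1) pos_divide_le_eq mult_ac)
qed

end

section \<open>Bounds on the expected chain length\<close>

text \<open>The ancestors of \<open>z\<close> lie on one upward path. Hence the subtrees of siblings
  are disjoint, and rerooting has a unique path to reverse.\<close>

lemma ancestor_linear:
  assumes "ancestor par z x" "ancestor par z y"
  shows "ancestor par x y \<or> ancestor par y x"
  using assms(1) unfolding ancestor_def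
proof (induction rule: rtrancl_induct)
  case base
  then show ?case using assms(2) by (simp add: ancestor_def)
next
  case (step u w)
  then have uw: "par u = Some w" by simp
  from step.IH show ?case
  proof
    assume "(u, y) \<in> {(y, p). par y = Some p}\<^sup>*"
    then show ?thesis
      using uw by (cases rule: converse_rtranclE) auto
  next
    assume "(y, u) \<in> {(y, p). par y = Some p}\<^sup>*"
    then show ?thesis using uw by (auto intro: rtrancl_into_rtrancl)
  qed
qed

lemma siblings_eq:
  assumes "forest par" "par x = Some w" "par y = Some w" "ancestor par x y"
  shows "x = y"
  using assms(4)
proof (cases rule: ancestor_cases)
  case (2 u)
  then show ?thesis using assms forest_no_return[OF assms(1,3)] by simp
qed

lemma sum_card_desc:
  fixes par :: "'v::finite parents"
  assumes "forest par"
  shows "1 + (\<Sum>x\<in>children par w. card (desc par x)) \<le> card (desc par w)"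
proof -
  have "(\<Sum>x\<in>children par w. card (desc par x)) = card (\<Union>x\<in>children par w. desc par x)"
  proof (rule card_UN_disjoint[symmetric])
    show "\<forall>x\<in>children par w. \<forall>y\<in>children par w. x \<noteq> y \<longrightarrow> desc par x \<inter> desc par y = {}"
    proof (intro ballI impI equals0I)
      fix x y z assume xy: "x \<in> children par w" "y \<in> children par w" "x \<noteq> y" and "z \<in> desc par x \<inter> desc par y"
      then have "ancestor par x y \<or> ancestor par y x" using ancestor_linear[of par z x y] by (simp add: desc_def)
      then show False
        using xy siblings_eq[OF assms, of x w y] siblings_eq[OF assms, of y w x] by (auto simp: children_def)
    qed
  qed auto
  moreover have "w \<notin> (\<Union>x\<in>children par w. desc par x)"
    using parent_notin_desc[OF assms] by (auto simp: children_def)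
  moreover have "insert w (\<Union>x\<in>children par w. desc par x) \<subseteq> desc par w"
    by (auto simp: children_def intro: subsetD[OF desc_child])
  ultimately show ?thesis
    using card_mono[of "desc par w" "insert w (\<Union>x\<in>children par w. desc par x)"] by simp
qed

text \<open>One edge of a nonroot leads to its parent, leaving at most \<open>\<Delta> - 1\<close>
  children. The inequality of \<open>supersolution\<close> is restricted to nonroots for this
  reason: the constant \<open>(\<kappa> - 1) / c\<close> violates it at a root with
  \<open>\<Delta>\<close> children.\<close>

lemma card_children_nonroot:
  fixes par :: "'v::finite parents"
  assumes "forest par" "par w \<noteq> None"
  shows "Suc (card (children par w)) = degree (edges par) w"
proof -
  obtain v where v: "par w = Some v" using assms(2) by auto
  have "{e \<in> edges par. w \<in> e} = insert {v, w} ((\<lambda>x. {w, x}) ` children par w)"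
  proof (intro equalityI subsetI)
    fix e assume "e \<in> {e \<in> edges par. w \<in> e}"
    then show "e \<in> insert {v, w} ((\<lambda>x. {w, x}) ` children par w)"
      using v by (auto simp: children_def elim!: edgeE)
  next
    fix e assume "e \<in> insert {v, w} ((\<lambda>x. {w, x}) ` children par w)"
    then show "e \<in> {e \<in> edges par. w \<in> e}" using v edgeI[of par] by (auto simp: children_def)
  qed
  moreover have "{v, w} \<notin> (\<lambda>x. {w, x}) ` children par w"
  proof
    assume "{v, w} \<in> (\<lambda>x. {w, x}) ` children par w"
    then obtain x where x: "par x = Some w" "{v, w} = {w, x}" by (auto simp: children_def)
    then have "w = x" using edge_eq_iff[OF assms(1) v x(1)] by simp
    then show False using parent_notin_desc[OF assms(1) x(1)] by simp
  qed
  moreover have "inj_on (\<lambda>x. {w, x}) (children par w)" by (auto simp: inj_on_def doubleton_eq_iff)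
  ultimately show ?thesis by (simp add: degree_def card_image)
qed

text \<open>The constant solves \<open>B = 1 + (\<Delta> - 1) * B / (\<kappa> - 1)\<close>, since
  \<open>\<kappa> - 1 = (\<Delta> - 1) + c\<close>.\<close>

lemma supersolution_geometric:
  fixes par :: "'v::finite parents"
  assumes "forest par" "\<And>x. degree (edges par) x \<le> \<Delta>" "1 \<le> c"
  shows "supersolution par (\<Delta> + c) (real (\<Delta> + c - 1) / real c) (\<lambda>_. real (\<Delta> + c - 1) / real c)"
  unfolding supersolution_def
proof (intro allI impI conjI order_refl)
  fix w assume "par w \<noteq> None"
  then have d: "Suc (card (children par w)) \<le> \<Delta>" using card_children_nonroot[OF assms(1)] assms(2) by metis
  then have k: "real (\<Delta> + c - 1) = real \<Delta> - 1 + real c" "real \<Delta> - 1 + real c > 0"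
    using assms(3) by (simp_all add: of_nat_diff)
  have "1 + (\<Sum>x\<in>children par w. real (\<Delta> + c - 1) / real c) / real (\<Delta> + c - 1)
      = 1 + real (card (children par w)) / real c"
    using k by simp
  also have "\<dots> \<le> real (\<Delta> + c - 1) / real c"
  proof -
    have "(real c + real (card (children par w))) / real c \<le> (real \<Delta> - 1 + real c) / real c"
      using d by (intro divide_right_mono) auto
    then show ?thesis using assms(3) unfolding k(1) by (simp add: add_divide_distrib)
  qed
  finally show "1 + (\<Sum>x\<in>children par w. real (\<Delta> + c - 1) / real c) / real (\<Delta> + c - 1) \<le> real (\<Delta> + c - 1) / real c" .
qed

text \<open>
  The first \<open>j\<close> levels contribute at most 1 each, and each vertex further down at most
  \<open>1 / (\<kappa> - 1) ^ j\<close>; the solution takes the best cut-off \<open>j \<le> J\<close>.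
\<close>

lemma supersolution_logarithmic:
  fixes par :: "'v::finite parents"
  assumes "forest par" "\<And>x. degree (edges par) x \<le> \<kappa>" "2 \<le> \<kappa>" "CARD('v) \<le> (\<kappa> - 1) ^ J"
  shows "\<exists>R. supersolution par \<kappa> (real J + 1) R"
proof -
  define k where "k = real (\<kappa> - 1)"
  have k: "k \<ge> 1" using assms(3) by (simp add: k_def)
  define h where "h = (\<lambda>w j. real j + real (card (desc par w)) / k ^ j)"
  define R where "R = (\<lambda>w. Min (h w ` {..J}))"
  have R_le: "R w \<le> h w j" if "j \<le> J" for w j
    unfolding R_def using that by (intro Min_le) auto
  have desc_sum: "1 + (\<Sum>x\<in>children par w. real (card (desc par x))) \<le> real (card (desc par w))" for w
    using sum_card_desc[OF assms(1), of w] by (metis of_nat_1 of_nat_add of_nat_le_iff of_nat_sum)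
  have "supersolution par \<kappa> (real J + 1) R"
    unfolding supersolution_def k_def[symmetric]
  proof (intro allI impI conjI)
    fix w assume w: "par w \<noteq> None"
    have "Suc (card (children par w)) \<le> \<kappa>" using card_children_nonroot[OF assms(1) w] assms(2) by metis
    then have ch: "real (card (children par w)) \<le> k" by (simp add: k_def)
    have "R w \<in> h w ` {..J}" unfolding R_def by (intro Min_in) auto
    then obtain j where j: "j \<le> J" "R w = h w j" by auto
    show "1 + (\<Sum>x\<in>children par w. R x) / k \<le> R w"
    proof (cases j)
      \<comment> \<open>Here \<open>R w\<close> is the size of the subtree. The division by
        \<open>k \<ge> 1\<close> is dropped, and the subtrees of the children together with
        \<open>w\<close> fit into that of \<open>w\<close>.\<close>
      case 0
      have "(\<Sum>x\<in>children par w. R x) / k \<le> (\<Sum>x\<in>children par w. h x 0) / k"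
        using k R_le[of 0] by (intro divide_right_mono sum_mono) auto
      also have "\<dots> \<le> (\<Sum>x\<in>children par w. h x 0)"
        using mult_left_mono[OF k, of "\<Sum>x\<in>children par w. h x 0"] k
        by (simp add: divide_le_eq h_def sum_nonneg)
      finally show ?thesis using desc_sum[of w] j 0 by (simp add: h_def)
    next
      \<comment> \<open>The children use the cut-off one level earlier: at most \<open>k\<close> of
        them contribute \<open>i\<close> each, and dividing by \<open>k\<close> leaves
        \<open>i\<close> and moves their sizes to the scale \<open>k ^ j\<close>.\<close>
      case (Suc i)
      have "(\<Sum>x\<in>children par w. R x) \<le> (\<Sum>x\<in>children par w. h x i)"
        using R_le[of i] j Suc by (intro sum_mono) auto
      also have "\<dots> = real (card (children par w)) * real i + (\<Sum>x\<in>children par w. real (card (desc par x))) / k ^ i"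
        by (simp add: h_def sum.distrib sum_divide_distrib)
      also have "\<dots> \<le> k * real i + real (card (desc par w)) / k ^ i"
        using ch k desc_sum[of w] by (intro add_mono mult_right_mono divide_right_mono) auto
      finally have "(\<Sum>x\<in>children par w. R x) / k \<le> (k * real i + real (card (desc par w)) / k ^ i) / k"
        using k by (intro divide_right_mono) auto
      also have "\<dots> = real i + real (card (desc par w)) / k ^ j"
        using k Suc by (simp add: field_simps)
      finally show ?thesis using j Suc by (simp add: h_def)
    qed
    have "real (card (desc par w)) \<le> k ^ J"
    proof -
      have "card (desc par w) \<le> CARD('v)" by (intro card_mono) auto
      also note assms(4)
      finally have "real (card (desc par w)) \<le> real ((\<kappa> - 1) ^ J)" by simp
      then show ?thesis by (simp add: k_def)
    qed
    \<comment> \<open>With cut-off \<open>J\<close> the vertices further down contribute at most 1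
      in total, as no subtree has more than \<open>k ^ J\<close> vertices.\<close>
    then have "h w J \<le> real J + 1" using k by (simp add: h_def divide_le_eq)
    with R_le[of J w] show "R w \<le> real J + 1" by simp
  qed
  then show ?thesis by blast
qed

section \<open>Rerooting\<close>

lemma ancestor_last_step:
  assumes "ancestor par v x" "x \<noteq> v"
  obtains y where "par y = Some x" "ancestor par v y"
proof -
  from assms(1) have "(v, x) \<in> {(y, p). par y = Some p}\<^sup>*" by (simp add: ancestor_def)
  then show thesis
  proof (cases rule: rtranclE)
    case base
    then show ?thesis using assms(2) by simp
  next
    case (step y)
    then show ?thesis by (intro that[of y]) (simp_all add: ancestor_def)
  qed
qed

text \<open>Makes the description operator in \<open>reroot\<close> well defined: two such vertices
  would be siblings on the same upward path.\<close>

lemma predecessor_unique: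
  assumes "forest par" "par y = Some x" "ancestor par v y" "par z = Some x" "ancestor par v z"
  shows "y = z"
  using ancestor_linear[OF assms(3,5)]
proof
  assume "ancestor par y z"
  then show ?thesis by (rule siblings_eq[OF assms(1,2,4)])
next
  assume "ancestor par z y"
  then have "z = y" by (rule siblings_eq[OF assms(1,4,2)])
  then show ?thesis by simp
qed

lemma reroot_simps:
  assumes "forest par"
  shows "reroot v par v = None"
    and "par y = Some x \<Longrightarrow> ancestor par v y \<Longrightarrow> reroot v par x = Some y"
    and "\<not> ancestor par v x \<Longrightarrow> reroot v par x = par x"
proof -
  show "reroot v par v = None" by (simp add: reroot_def)
  show "reroot v par x = par x" if "\<not> ancestor par v x" using that by (auto simp: reroot_def)
  show "reroot v par x = Some y" if y: "par y = Some x" "ancestor par v y"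
  proof -
    have "x \<noteq> v" using forest_no_return[OF assms y(1)] y(2) by auto
    moreover have "ancestor par v x" using y by (auto intro: ancestor_trans ancestor_parent)
    moreover have "(THE z. par z = Some x \<and> ancestor par v z) = y"
      using y predecessor_unique[OF assms] by (intro the_equality) blast+
    ultimately show ?thesis by (simp add: reroot_def)
  qed
qed

lemma reroot_cases:
  assumes "forest par" "reroot v par x = Some y"
  obtains "par y = Some x" "ancestor par v y" "ancestor par v x" | "\<not> ancestor par v x" "par x = Some y"
proof (cases "ancestor par v x")
  case True
  have "x \<noteq> v" using assms reroot_simps(1)[OF assms(1)] by auto
  with True obtain z where z: "par z = Some x" "ancestor par v z" by (auto elim: ancestor_last_step)
  then have "y = z" using reroot_simps(2)[OF assms(1) z] assms(2) by simp
  with z True that show ?thesis by blast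
next
  case False
  with reroot_simps(3)[OF assms(1) False] assms(2) that show ?thesis by simp
qed

lemma edges_reroot:
  assumes "forest par"
  shows "edges (reroot v par) = edges par"
proof (intro equalityI subsetI)
  fix e assume "e \<in> edges (reroot v par)"
  then obtain x y where xy: "reroot v par x = Some y" "e = {y, x}" by (rule edgeE)
  from assms xy(1) show "e \<in> edges par"
    by (cases rule: reroot_cases) (use xy(2) edgeI[of par x y] edgeI[of par y x] in \<open>simp_all add: insert_commute\<close>)
next
  fix e assume "e \<in> edges par"
  then obtain x y where xy: "par x = Some y" "e = {y, x}" by (rule edgeE)
  show "e \<in> edges (reroot v par)"
  proof (cases "ancestor par v x")
    case True
    then show ?thesis
      using reroot_simps(2)[OF assms xy(1)] edgeI[of "reroot v par" y x] xy(2) by (simp add: insert_commute)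
  next
    case False
    then show ?thesis
      using reroot_simps(3)[OF assms False] edgeI[of "reroot v par" x y] xy by simp
  qed
qed

text \<open>Along new parent links the reversed path is never left once reached: on it the old links
  run backwards, before it they run forwards. A cycle lies wholly on or wholly off the path, and so
  gives a cycle of the old links.\<close>

lemma forest_reroot:
  assumes "forest par"
  shows "forest (reroot v par)"
proof -
  let ?P = "{(y, p). par y = Some p}"
  let ?N = "{(y, p). reroot v par y = Some p}"
  have "(if ancestor par v x then ancestor par v y \<and> (y, x) \<in> ?P\<^sup>+
         else ancestor par v y \<or> (x, y) \<in> ?P\<^sup>+)" if "(x, y) \<in> ?N\<^sup>+" for x y
    using that
  proof (induction rule: trancl_induct)
    case (base y)
    then have "reroot v par x = Some y" by simp
    with assms show ?case by (cases rule: reroot_cases) auto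
  next
    case (step y z)
    then have "reroot v par y = Some z" by simp
    with assms show ?case
    proof (cases rule: reroot_cases)
      case 1
      then have "(z, y) \<in> ?P" by simp
      with step.IH 1 show ?thesis by (auto split: if_splits intro: trancl_into_trancl2)
    next
      case 2
      then have "(y, z) \<in> ?P" by simp
      with step.IH 2 show ?thesis by (auto split: if_splits intro: trancl_into_trancl)
    qed
  qed
  moreover have "(x, x) \<notin> ?P\<^sup>+" for x
    using assms by (simp add: forest_def acyclic_def)
  ultimately have "(x, x) \<notin> ?N\<^sup>+" for x
    by (cases "ancestor par v x") force+
  then show ?thesis by (simp add: forest_def acyclic_def)
qed

section \<open>Running the algorithm\<close>

definition good :: "nat \<Rightarrow> nat \<Rightarrow> 'v parents \<Rightarrow> bool" where
  "good \<kappa> \<Delta> par \<longleftrightarrow> forest par \<and> (\<forall>x. degree (edges par) x \<le> \<Delta>) \<and> proper \<kappa> (edges par) \<noteq> {}"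

text \<open>Only the colouring is random: the new parent map is determined by the update and the old
  one. So uniformity can be stated over a single \<open>par'\<close>, and the invariant can be
  iterated.\<close>

definition step_ok :: "nat \<Rightarrow> nat \<Rightarrow> real \<Rightarrow> 'v parents \<Rightarrow> ('v state \<Rightarrow> 'v state pmf) \<Rightarrow> 'v parents \<Rightarrow> bool" where
  "step_ok \<kappa> \<Delta> B par step par' \<longleftrightarrow> good \<kappa> \<Delta> par' \<and>
     uniform_state \<kappa> par \<bind> step = uniform_state \<kappa> par' \<and>
     step_recourse (uniform_state \<kappa> par) step \<le> real \<Delta> / real \<kappa> * B"

text \<open>Separates the bound on chains from the run of updates. It covers all forests of the
  given degree, since the parent map changes over time; the last argument fixes the vertex type and
  thereby the number of vertices.\<close>

definition chains_bounded :: "nat \<Rightarrow> nat \<Rightarrow> real \<Rightarrow> 'v itself \<Rightarrow> bool" where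
  "chains_bounded \<kappa> \<Delta> B _ \<longleftrightarrow> 0 \<le> B \<and>
     (\<forall>par :: 'v parents. forest par \<longrightarrow> (\<forall>x. degree (edges par) x \<le> \<Delta>) \<longrightarrow> (\<exists>R. supersolution par \<kappa> B R))"

lemma degree_mono:
  assumes "E \<subseteq> F"
  shows "degree E (x :: 'v::finite) \<le> degree F x"
  unfolding degree_def using assms by (intro card_mono) auto

lemma degree_insert:
  assumes "e \<notin> E" "(x :: 'v::finite) \<in> e"
  shows "degree (insert e E) x = Suc (degree E x)"
proof -
  have "{f \<in> insert e E. x \<in> f} = insert e {f \<in> E. x \<in> f}" using assms(2) by auto
  then show ?thesis using assms(1) by (simp add: degree_def)
qed

lemma edge_updateI:
  fixes par :: "'v::finite parents"
  assumes "forest par" "par r = None" "\<not> ancestor par p r"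
    and deg: "\<And>x. degree (insert {p, r} (edges par)) x \<le> \<Delta>" and "\<Delta> \<le> \<kappa>"
  shows "edge_update par p r \<kappa>" "card (children par r) \<le> \<Delta>"
proof -
  have "Suc (degree (edges par) x) \<le> \<Delta>" if "x \<in> {p, r}" for x
    using deg[of x] degree_insert[OF link_notin_edges[OF assms(2,3)] that] by simp
  from this[of p] this[of r] show "edge_update par p r \<kappa>" "card (children par r) \<le> \<Delta>"
    using assms by (auto simp: edge_update_def degree_root)
qed

lemma step_ok_bound:
  assumes "x \<le> real k * B / real \<kappa>" "k \<le> \<Delta>" "0 \<le> B"
  shows "x \<le> real \<Delta> / real \<kappa> * B"
proof -
  note assms(1)
  also have "real k * B / real \<kappa> \<le> real \<Delta> * B / real \<kappa>"
    using assms(2,3) by (intro divide_right_mono mult_right_mono) auto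
  finally show ?thesis by simp
qed

lemma link_ok:
  fixes par :: "'v::finite parents"
  assumes "chains_bounded \<kappa> \<Delta> B TYPE('v)" "\<Delta> \<le> \<kappa>" "good \<kappa> \<Delta> par" "par r = None" "\<not> ancestor par p r"
    and deg: "\<And>x. degree (insert {p, r} (edges par)) x \<le> \<Delta>"
  shows "step_ok \<kappa> \<Delta> B par (rooted_insert \<kappa> p r) (par(r \<mapsto> p))"
proof -
  have F: "forest par" and ne: "proper \<kappa> (edges par) \<noteq> {}"
    using assms(3) by (auto simp: good_def)
  note U = edge_updateI[OF F assms(4,5) deg assms(2)]
  interpret edge_update par p r \<kappa> by (rule U(1))
  obtain R where R: "supersolution par \<kappa> B R" and B: "0 \<le> B"
    using assms(1,3) by (auto simp: chains_bounded_def good_def)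
  note S = insert_step[OF ne R]
  have "forest (par(r \<mapsto> p))" using F assms(4,5) by (rule forest_link)
  then have "good \<kappa> \<Delta> (par(r \<mapsto> p))" using S(1) deg by (simp add: good_def edges_par' del: fun_upd_apply)
  then show ?thesis unfolding step_ok_def using S(2) step_ok_bound[OF S(3) U(2) B] by blast
qed

lemma cut_ok:
  fixes par :: "'v::finite parents"
  assumes "chains_bounded \<kappa> \<Delta> B TYPE('v)" "\<Delta> \<le> \<kappa>" "good \<kappa> \<Delta> par" "par r = Some p"
  shows "step_ok \<kappa> \<Delta> B par (rooted_delete \<kappa> p r) (par(r := None))"
    and "edges (par(r := None)) = edges par - {{p, r}}"
proof -
  let ?par = "par(r := None)"
  have F: "forest par" and ne: "proper \<kappa> (edges par) \<noteq> {}" and deg: "\<And>x. degree (edges par) x \<le> \<Delta>"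
    using assms(3) by (auto simp: good_def)
  have sub: "{(y, q). ?par y = Some q} \<subseteq> {(y, q). par y = Some q}" by (auto split: if_splits)
  have F': "forest ?par" using F acyclic_subset[OF _ sub] by (simp add: forest_def)
  have "\<not> ancestor ?par p r"
    using forest_no_return[OF F assms(4)] rtrancl_mono[OF sub] by (auto simp: ancestor_def)
  moreover have r: "?par r = None" by simp
  ultimately have fresh: "?par r = None" "\<not> ancestor ?par p r" by blast+
  \<comment> \<open>The deletion is viewed from the cut forest, in which \<open>{p, r}\<close> is
    the edge to be linked.\<close>
  have par: "?par(r \<mapsto> p) = par" using assms(4) by auto
  have E: "edges par = insert {p, r} (edges ?par)" using edges_link[of ?par r p, OF r] par by simp
  then show E': "edges ?par = edges par - {{p, r}}" using link_notin_edges[OF fresh] by simp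
  have "\<And>x. degree (insert {p, r} (edges ?par)) x \<le> \<Delta>" using deg E by simp
  note U = edge_updateI[OF F' fresh this assms(2)]
  interpret edge_update ?par p r \<kappa> by (rule U(1))
  have "edges ?par \<subseteq> edges par" using E' by blast
  then have deg': "degree (edges ?par) x \<le> \<Delta>" for x
    using order_trans[OF degree_mono deg] by blast
  obtain R where R: "supersolution ?par \<kappa> B R" and B: "0 \<le> B"
    using assms(1) F' deg' by (auto simp: chains_bounded_def)
  note S = delete_step[OF ne[unfolded E] R, unfolded par]
  have "good \<kappa> \<Delta> ?par" using S(1) F' deg' by (simp add: good_def del: fun_upd_apply)
  then show "step_ok \<kappa> \<Delta> B par (rooted_delete \<kappa> p r) ?par"
    unfolding step_ok_def using S(2) step_ok_bound[OF S(3) U(2) B] by blast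
qed

lemma ancestor_same_tree:
  assumes "ancestor par x y"
  shows "same_tree (edges par) x y"
proof -
  have "{(y, p). par y = Some p} \<subseteq> {(x, y). {x, y} \<in> edges par}"
    using edgeI[of par] by (auto simp: insert_commute)
  from rtrancl_mono[OF this] assms show ?thesis by (auto simp: ancestor_def same_tree_def)
qed

lemma same_tree_sym:
  assumes "same_tree E u v"
  shows "same_tree E v u"
proof -
  have "sym {(x, y). {x, y} \<in> E}" by (auto simp: sym_def insert_commute)
  from sym_rtrancl[OF this] assms show ?thesis by (auto simp: same_tree_def dest: symD)
qed

lemma good_reroot: "good \<kappa> \<Delta> par \<Longrightarrow> good \<kappa> \<Delta> (reroot v par)"
  by (simp add: good_def forest_reroot edges_reroot)

text \<open>Proper colourings depend only on the edge set and recourse ignores the parent map. Hence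
  a step on \<open>par\<close> may be replaced by one on a rerooted forest that acts alike on proper
  colourings, the only ones with positive probability.\<close>

lemma step_ok_transfer:
  fixes par :: "'v::finite parents"
  assumes ok: "step_ok \<kappa> \<Delta> B par0 step par'" and E: "edges par0 = edges par" and ne: "proper \<kappa> (edges par) \<noteq> {}"
    and eq: "\<And>c. c \<in> proper \<kappa> (edges par) \<Longrightarrow> step' (par, c) = step (par0, c)"
  shows "step_ok \<kappa> \<Delta> B par step' par'"
proof -
  have supp: "set_pmf (pmf_of_set (proper \<kappa> (edges par))) = proper \<kappa> (edges par)"
    using ne finite_proper by (intro set_pmf_of_set)
  have rec: "recourse (par, c) = recourse (par0, c)" for c by (rule ext) (simp add: recourse_def)
  have "uniform_state \<kappa> par \<bind> step' = uniform_state \<kappa> par0 \<bind> step"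
    unfolding uniform_state_def bind_map_pmf E by (intro bind_pmf_cong refl) (simp_all add: supp eq)
  moreover have "uniform_state \<kappa> par \<bind> (\<lambda>s. step' s \<bind> (\<lambda>s'. return_pmf (recourse s s'))) =
      uniform_state \<kappa> par0 \<bind> (\<lambda>s. step s \<bind> (\<lambda>s'. return_pmf (recourse s s')))"
    unfolding uniform_state_def bind_map_pmf E by (intro bind_pmf_cong refl) (simp_all add: supp eq rec)
  ultimately show ?thesis using ok by (simp add: step_ok_def step_recourse_def)
qed

lemma rooted_step_ok:
  fixes par :: "'v::finite parents"
  assumes "chains_bounded \<kappa> \<Delta> B TYPE('v)" "\<Delta> \<le> \<kappa>" "good \<kappa> \<Delta> par" "legal_rooted \<Delta> par (u # us)"
  shows "\<exists>par'. step_ok \<kappa> \<Delta> B par (dist_maint_step Rooted \<Delta> \<kappa> u) par' \<and> legal_rooted \<Delta> par' us"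
proof (cases u)
  case (Insert p r)
  then have L: "par r = None" "\<not> same_tree (edges par) p r" "\<And>x. degree (edges (par(r \<mapsto> p))) x \<le> \<Delta>"
      "legal_rooted \<Delta> (par(r \<mapsto> p)) us"
    using assms(4) by simp_all
  have "\<not> ancestor par p r" using L(2) ancestor_same_tree by metis
  then have "step_ok \<kappa> \<Delta> B par (rooted_insert \<kappa> p r) (par(r \<mapsto> p))"
    using link_ok[OF assms(1-3) L(1)] L(3) edges_link[of par r p, OF L(1)] by simp
  then show ?thesis using L(4) Insert by (intro exI[of _ "par(r \<mapsto> p)"]) (simp del: fun_upd_apply)
next
  case (Delete p r)
  then have L: "par r = Some p" "legal_rooted \<Delta> (par(r := None)) us" using assms(4) by simp_all
  show ?thesis using cut_ok(1)[OF assms(1-3) L(1)] L(2) Delete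
    by (intro exI[of _ "par(r := None)"]) (simp del: fun_upd_apply)
qed

text \<open>Stated for any step that attaches \<open>v\<close> below \<open>u\<close>, so that it
  serves both outcomes of the naming rule, with the endpoints exchanged in one of them.\<close>

lemma unrooted_insert_ok:
  fixes par :: "'v::finite parents"
  assumes "chains_bounded \<kappa> \<Delta> B TYPE('v)" "\<Delta> \<le> \<kappa>" "good \<kappa> \<Delta> par" "\<not> same_tree (edges par) u v"
    and deg: "\<And>x. degree (insert {u, v} (edges par)) x \<le> \<Delta>"
    and eq: "\<And>c. step (par, c) = rooted_insert \<kappa> u v (reroot v par, c)"
  shows "\<exists>par'. step_ok \<kappa> \<Delta> B par step par' \<and> edges par' = insert {u, v} (edges par)"
proof -
  let ?par = "reroot v par"
  have F: "forest par" and ne: "proper \<kappa> (edges par) \<noteq> {}" using assms(3) by (auto simp: good_def)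
  have E: "edges ?par = edges par" by (rule edges_reroot[OF F])
  have v: "?par v = None" by (rule reroot_simps(1)[OF F])
  have "\<not> ancestor ?par u v" using assms(4) ancestor_same_tree[of ?par u v] E by auto
  then have "step_ok \<kappa> \<Delta> B ?par (rooted_insert \<kappa> u v) (?par(v \<mapsto> u))"
    using deg E by (intro link_ok[OF assms(1,2) good_reroot[OF assms(3)] v]) auto
  then have "step_ok \<kappa> \<Delta> B par step (?par(v \<mapsto> u))"
    by (rule step_ok_transfer[OF _ E ne]) (rule eq)
  moreover have "edges (?par(v \<mapsto> u)) = insert {u, v} (edges par)"
    using edges_link[of ?par v u, OF v] E by simp
  ultimately show ?thesis by blast
qed

lemma unrooted_step_ok:
  fixes par :: "'v::finite parents"
  assumes "chains_bounded \<kappa> \<Delta> B TYPE('v)" "\<Delta> \<le> \<kappa>" "good \<kappa> \<Delta> par" "legal_unrooted \<Delta> (edges par) (x # us)"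
  shows "\<exists>par'. step_ok \<kappa> \<Delta> B par (dist_maint_step Unrooted \<Delta> \<kappa> x) par' \<and> legal_unrooted \<Delta> (edges par') us"
proof (cases x)
  case (Insert u v)
  then have L: "\<not> same_tree (edges par) u v" "\<And>y. degree (insert {u, v} (edges par)) y \<le> \<Delta>"
      "legal_unrooted \<Delta> (insert {u, v} (edges par)) us"
    using assms(4) by simp_all
  have "\<exists>par'. step_ok \<kappa> \<Delta> B par (unrooted_insert \<Delta> \<kappa> u v) par' \<and> edges par' = insert {u, v} (edges par)"
  proof (cases "admissible_naming \<Delta> (edges par) u v")
    case True
    then show ?thesis
      using L by (intro unrooted_insert_ok[OF assms(1-3)]) (simp_all add: unrooted_insert_def)
  next
    case False
    have "\<not> same_tree (edges par) v u" using L(1) same_tree_sym by metis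
    then have "\<exists>par'. step_ok \<kappa> \<Delta> B par (unrooted_insert \<Delta> \<kappa> u v) par' \<and> edges par' = insert {v, u} (edges par)"
      using L(2) False
      by (intro unrooted_insert_ok[OF assms(1-3)]) (simp_all add: unrooted_insert_def insert_commute)
    then show ?thesis by (simp add: insert_commute)
  qed
  then show ?thesis using L(3) Insert by auto
next
  case (Delete u v)
  have ne: "proper \<kappa> (edges par) \<noteq> {}" using assms(3) by (simp add: good_def)
  have L: "{u, v} \<in> edges par" "legal_unrooted \<Delta> (edges par - {{u, v}}) us"
    using assms(4) Delete by simp_all
  have "\<exists>par'. step_ok \<kappa> \<Delta> B par (unrooted_delete \<kappa> u v) par' \<and> edges par' = edges par - {{u, v}}"
  proof (cases "par v = Some u")
    case True
    have "step_ok \<kappa> \<Delta> B par (unrooted_delete \<kappa> u v) (par(v := None))"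
      by (rule step_ok_transfer[OF cut_ok(1)[OF assms(1-3) True] refl ne])
         (simp add: unrooted_delete_def True)
    then show ?thesis using cut_ok(2)[OF assms(1-3) True] by blast
  next
    case False
    then have vu: "par u = Some v" using L(1) by (auto simp: edges_def doubleton_eq_iff)
    have "step_ok \<kappa> \<Delta> B par (unrooted_delete \<kappa> u v) (par(u := None))"
      by (rule step_ok_transfer[OF cut_ok(1)[OF assms(1-3) vu] refl ne])
         (simp add: unrooted_delete_def False)
    then show ?thesis using cut_ok(2)[OF assms(1-3) vu] by (metis insert_commute)
  qed
  then show ?thesis using L(2) Delete by auto
qed

text \<open>After the first update the state is again uniform over one forest, so updates can be
  peeled off the front of the list. Legality is a parameter, as it refers to the parent map in one
  version and to the edges alone in the other.\<close>

lemma run_recourse: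
  fixes par :: "'v::finite parents"
  assumes step: "\<And>par u us. good \<kappa> \<Delta> par \<Longrightarrow> L par (u # us) \<Longrightarrow>
      \<exists>par'. step_ok \<kappa> \<Delta> B par (dist_maint_step ver \<Delta> \<kappa> u) par' \<and> L par' us"
    and "good \<kappa> \<Delta> par" "L par us" "i < length us"
  shows "step_recourse
      (foldl (\<lambda>S u. S \<bind> dist_maint_step ver \<Delta> \<kappa> u) (uniform_state \<kappa> par) (take i us))
      (dist_maint_step ver \<Delta> \<kappa> (us ! i)) \<le> real \<Delta> / real \<kappa> * B"
  using assms(2-)
proof (induction us arbitrary: par i)
  case (Cons u us)
  obtain par' where par': "step_ok \<kappa> \<Delta> B par (dist_maint_step ver \<Delta> \<kappa> u) par'" "L par' us"
    using step[OF Cons.prems(1,2)] by blast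
  show ?case
  proof (cases i)
    case 0
    then show ?thesis using par'(1) by (simp add: step_ok_def)
  next
    case (Suc j)
    then show ?thesis
      using Cons.IH[of par' j] par' Cons.prems(3) by (simp add: step_ok_def)
  qed
qed simp

lemma edges_empty [simp]: "edges (\<lambda>_. None) = {}"
  by (simp add: edges_def)

lemma proper_empty [simp]: "proper \<kappa> {} = {\<lambda>_. None}"
  by (auto simp: proper_def)

lemma uniform_state_empty: "uniform_state \<kappa> (\<lambda>_. None) = return_pmf (\<lambda>_. None, \<lambda>_. None)"
  by (simp add: uniform_state_def pmf_of_set_singleton)

lemma good_empty: "good \<kappa> \<Delta> (\<lambda>_. None)"
  by (simp add: good_def forest_def acyclic_def degree_def)

lemma expected_recourse_bound:
  fixes us :: "'v::finite update list"
  assumes "chains_bounded \<kappa> \<Delta> B TYPE('v)" "\<Delta> \<le> \<kappa>" "legal ver \<Delta> us" "i < length us"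
  shows "expected_recourse ver \<Delta> \<kappa> us i \<le> real \<Delta> / real \<kappa> * B"
proof -
  have "step_recourse
      (foldl (\<lambda>S u. S \<bind> dist_maint_step ver \<Delta> \<kappa> u) (uniform_state \<kappa> (\<lambda>_. None)) (take i us))
      (dist_maint_step ver \<Delta> \<kappa> (us ! i)) \<le> real \<Delta> / real \<kappa> * B"
  proof (cases ver)
    case Rooted
    show ?thesis
      using assms(3,4) rooted_step_ok[OF assms(1,2)] good_empty unfolding Rooted
      by (intro run_recourse[where L = "legal_rooted \<Delta>"]) auto
  next
    case Unrooted
    show ?thesis
      using assms(3,4) unrooted_step_ok[OF assms(1,2)] good_empty unfolding Unrooted
      by (intro run_recourse[where L = "\<lambda>par. legal_unrooted \<Delta> (edges par)"]) auto
  qed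
  then show ?thesis
    by (simp add: expected_recourse_def dist_maint_def step_recourse_def uniform_state_empty)
qed

lemma chains_bounded_geometric:
  assumes "1 \<le> c"
  shows "chains_bounded (\<Delta> + c) \<Delta> (real (\<Delta> + c - 1) / real c) TYPE('v::finite)"
  unfolding chains_bounded_def
proof (intro conjI allI impI)
  fix par :: "'v parents" assume "forest par" "\<forall>x. degree (edges par) x \<le> \<Delta>"
  then have "supersolution par (\<Delta> + c) (real (\<Delta> + c - 1) / real c) (\<lambda>_. real (\<Delta> + c - 1) / real c)"
    using assms by (intro supersolution_geometric) auto
  then show "\<exists>R. supersolution par (\<Delta> + c) (real (\<Delta> + c - 1) / real c) R" by blast
qed simp

lemma chains_bounded_logarithmic:
  assumes "\<Delta> \<le> \<kappa>" "3 \<le> \<kappa>"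
  shows "chains_bounded \<kappa> \<Delta> (2 + real_of_int \<lceil>log (real (\<kappa> - 1)) (real CARD('v))\<rceil>) TYPE('v::finite)"
proof -
  let ?k = "real (\<kappa> - 1)" and ?n = "real CARD('v)"
  define J where "J = nat \<lceil>log ?k ?n\<rceil>"
  have k: "?k > 1" using assms(2) by simp
  have n: "?n \<ge> 1" by (simp add: Suc_leI)
  have "0 \<le> log ?k ?n" using k n by simp
  then have J: "real J = real_of_int \<lceil>log ?k ?n\<rceil>" by (simp add: J_def)
  \<comment> \<open>\<open>J\<close> is the rounded-up logarithm, so \<open>k ^ J\<close> is at
    least the number of vertices.\<close>
  have "?n = ?k powr log ?k ?n" using k n by simp
  also have "\<dots> \<le> ?k powr real J" using k unfolding J by (intro powr_mono) auto
  also have "\<dots> = real ((\<kappa> - 1) ^ J)" using k by (simp add: powr_realpow)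
  finally have "CARD('v) \<le> (\<kappa> - 1) ^ J" by (simp only: of_nat_le_iff)
  then have ex: "\<exists>R. supersolution par \<kappa> (real J + 1) R"
    if "forest par" "\<forall>x. degree (edges par) x \<le> \<Delta>" for par :: "'v parents"
    using that assms by (intro supersolution_logarithmic) (auto intro: order_trans)
  \<comment> \<open>The bound \<open>real J + 1\<close> is relaxed by one to the form used in the
    theorem.\<close>
  have "\<exists>R. supersolution par \<kappa> (2 + real J) R"
    if "forest par" "\<forall>x. degree (edges par) x \<le> \<Delta>" for par :: "'v parents"
    using ex[OF that] by (force simp: supersolution_def)
  then show ?thesis unfolding chains_bounded_def J[symmetric] by simp
qed

theorem theorem4p15:
  fixes \<Delta> c \<kappa> n i :: nat and ver :: version and us :: "'v::finite update list"
  assumes "\<Delta> \<ge> 3" and "c \<le> \<Delta> - 2" and "\<kappa> = \<Delta> + c"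
    and "n = CARD('v)"
    and "legal ver \<Delta> us" and "i < length us"
  shows "(c \<ge> 1 \<longrightarrow>
            expected_recourse ver \<Delta> \<kappa> us i \<le>
              real \<Delta> / real \<kappa> *
                min (real (\<kappa> - 1) / real c) (2 + real_of_int \<lceil>log (real (\<kappa> - 1)) (real n)\<rceil>)) \<and>
         (c = 0 \<longrightarrow>
            expected_recourse ver \<Delta> \<kappa> us i \<le>
              2 + real_of_int \<lceil>log (real (\<Delta> - 1)) (real n)\<rceil>)"
proof -
  have le: "\<Delta> \<le> \<kappa>" "3 \<le> \<kappa>" using assms(1,3) by simp_all
  have log: "expected_recourse ver \<Delta> \<kappa> us i \<le>
      real \<Delta> / real \<kappa> * (2 + real_of_int \<lceil>log (real (\<kappa> - 1)) (real n)\<rceil>)"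
    using expected_recourse_bound[OF chains_bounded_logarithmic[OF le] le(1) assms(5,6)] assms(4) by simp
  have geo: "expected_recourse ver \<Delta> \<kappa> us i \<le> real \<Delta> / real \<kappa> * (real (\<kappa> - 1) / real c)" if "1 \<le> c"
    using expected_recourse_bound[OF chains_bounded_geometric[OF that] _ assms(5,6)] assms(3) by simp
  show ?thesis
  proof (intro conjI impI)
    assume "1 \<le> c"
    with geo log show "expected_recourse ver \<Delta> \<kappa> us i \<le> real \<Delta> / real \<kappa> *
        min (real (\<kappa> - 1) / real c) (2 + real_of_int \<lceil>log (real (\<kappa> - 1)) (real n)\<rceil>)"
      unfolding min_def by presburger
  next
    \<comment> \<open>Now \<open>\<kappa> = \<Delta>\<close>, so the factor
      \<open>\<Delta> / \<kappa>\<close> is 1.\<close>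
    assume "c = 0"
    with log show "expected_recourse ver \<Delta> \<kappa> us i \<le> 2 + real_of_int \<lceil>log (real (\<Delta> - 1)) (real n)\<rceil>"
      using assms(1,3) by simp
  qed
qed

end
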